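(* Let $\boldsymbol u\in\mathbb R^d$ with $|\boldsymbol u|<c$, and consider the two-step transport $w(\mathrm d\boldsymbol u)\,w(\boldsymbol u)$ with infinitesimal second step $\mathrm d\boldsymbol u$. Then $$q_{00}=1-\frac{2\,\boldsymbol u\cdot\mathrm d\boldsymbol u}{c^2-|\boldsymbol u|^2}+O(|\mathrm d\boldsymbol u|^2),\qquad\text{hence}\qquad \mathrm d\ln\rho=\frac{\boldsymbol u\cdot\mathrm d\boldsymbol u}{c^2-|\boldsymbol u|^2}=\mathrm d\ln\gamma(\boldsymbol u).$$ The frequency connection form is exact. Consequently: continuum transport along any smooth path in $\{|\boldsymbol u|<c\}$ from $\boldsymbol u_a$ to $\boldsymbol u_b$ multiplies frequencies by $\gamma(\boldsymbol u_b)/\gamma(\boldsymbol u_a)$, independently of the path; every smooth loop has trivial frequency holonomy; and the discrete two-step dilation $\rho=\gamma(\boldsymbol w)/(\gamma(\boldsymbol u_1)\gamma(\boldsymbol u_2))$ of finite steps $\boldsymbol u_1,\boldsymbol u_2$ is precisely the $\gamma$-composition defect. Moreover the rotation of the two-step holonomy with steps $\boldsymbol u,\mathrm d\boldsymbol u$ is quadratic in the increment (angle $O(|\mathrm d\boldsymbol u|^2)$), so the rotation channel also vanishes in the continuum limit: the boost sector is continuum-flat.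
   Context: Fix $c>0$, $d\in\{2,3\}$; coordinates $(t,\boldsymbol x)\in\mathbb R^{1+d}$, index $0$ for $t$; $Q_*=\begin{pmatrix}1&0\\0&-c^2I\end{pmatrix}$; $\gamma(\boldsymbol v)=(1-|\boldsymbol v|^2/c^2)^{-1/2}$. For $|\boldsymbol v|<c$, $\hat{\boldsymbol v}=\boldsymbol v/|\boldsymbol v|$ (terms with $\hat{\boldsymbol v}$ read as $0$ if $\boldsymbol v=0$), define linear maps (matrices) $g(\boldsymbol v):(t,\boldsymbol x)\mapsto(t,\boldsymbol x-\boldsymbol vt)$, $\ell(\boldsymbol v):(t,\boldsymbol x)\mapsto\bigl(\gamma(t-\boldsymbol v\cdot\boldsymbol x/c^2),\ \boldsymbol x+(\gamma-1)(\hat{\boldsymbol v}\cdot\boldsymbol x)\hat{\boldsymbol v}-\gamma\boldsymbol vt\bigr)$ with $\gamma=\gamma(\boldsymbol v)$, and $w(\boldsymbol v)=\ell(-\boldsymbol v)g(\boldsymbol v)$. For steps $\boldsymbol u_1,\boldsymbol u_2$ put $W=w(\boldsymbol u_2)w(\boldsymbol u_1)$, $q_{00}=(W^{-1}Q_*W^{-\mathrm T})_{00}$, $\rho=q_{00}^{-1/2}$ (when $q_{00}>0$), and $\boldsymbol w=(1-\boldsymbol u_1\cdot\boldsymbol u_2/c^2)\boldsymbol u_2+\boldsymbol u_1/\gamma(\boldsymbol u_2)+(1-1/\gamma(\boldsymbol u_2))(\hat{\boldsymbol u}_2\cdot\boldsymbol u_1)\hat{\boldsymbol u}_2$. The rotation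 $R\in SO(d)$ of the two-step holonomy is the orthogonal factor in the polar decomposition $S_W=R\,P$ ($P\succ0$) of the spatial $d\times d$ block $S_W$ of $W$. The frequency connection form is the one-form on $\{|\boldsymbol u|<c\}$ giving the first-order part $\mathrm d\ln\rho$ of $\ln\rho$ at $\boldsymbol u_1=\boldsymbol u$, $\boldsymbol u_2=\mathrm d\boldsymbol u$; continuum transport along a smooth path multiplies frequencies by the exponential of its line integral. "Continuum-flat" means that this one-form has trivial integral over every smooth loop and that the per-step rotation is of second order in the increment (so that its accumulation over $N$ steps of size $O(1/N)$ tends to $0$). *)

theory Defs
  imports "HOL-Analysis.Analysis" "HOL-Library.Landau_Symbols"
begin

section \<open>Space-time, boosts and the step map\<close>

text \<open>
  A spatial vector is of type \<open>real ^ 'n\<close>. Space-time vectors are indexed by \<open>'n option\<close>, where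
  \<open>None\<close> is the time index and \<open>Some i\<close> are the spatial indices.
\<close>

definition event :: "real \<Rightarrow> real ^ 'n \<Rightarrow> real ^ ('n::finite) option" where
  "event t x = (\<chi> k. case k of None \<Rightarrow> t | Some i \<Rightarrow> x $ i)"

definition time_part :: "real ^ ('n::finite) option \<Rightarrow> real" where
  "time_part X = X $ None"

definition space_part :: "real ^ ('n::finite) option \<Rightarrow> real ^ 'n" where
  "space_part X = (\<chi> i. X $ Some i)"

text \<open>Only meaningful for \<open>norm v < c\<close>.\<close>

definition gam :: "real \<Rightarrow> real ^ 'n::finite \<Rightarrow> real" where
  "gam c v = 1 / sqrt (1 - (norm v)\<^sup>2 / c\<^sup>2)"

definition Qstar :: "real \<Rightarrow> real ^ ('n::finite) option ^ 'n option" where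
  "Qstar c = (\<chi> i j. if i = j then (if i = None then 1 else - c\<^sup>2) else 0)"

definition galilei :: "real ^ 'n \<Rightarrow> real ^ ('n::finite) option ^ 'n option" where
  "galilei v = matrix (\<lambda>X. event (time_part X) (space_part X - time_part X *\<^sub>R v))"

text \<open>The unit vector in direction \<open>v\<close> is \<open>sgn v\<close>, which is \<open>0\<close> for \<open>v = 0\<close>.\<close>

definition lorentz :: "real \<Rightarrow> real ^ 'n \<Rightarrow> real ^ ('n::finite) option ^ 'n option" where
  "lorentz c v = matrix (\<lambda>X.
     event (gam c v * (time_part X - (v \<bullet> space_part X) / c\<^sup>2))
           (space_part X + ((gam c v - 1) * (sgn v \<bullet> space_part X)) *\<^sub>R sgn v
              - (gam c v * time_part X) *\<^sub>R v))"

definition step :: "real \<Rightarrow> real ^ 'n \<Rightarrow> real ^ ('n::finite) option ^ 'n option" where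
  "step c v = lorentz c (- v) ** galilei v"

text \<open>The step with velocity \<open>u1\<close> acts first.\<close>

definition two_step :: "real \<Rightarrow> real ^ 'n \<Rightarrow> real ^ 'n \<Rightarrow> real ^ ('n::finite) option ^ 'n option" where
  "two_step c u1 u2 = step c u2 ** step c u1"

section \<open>Two-step dilation\<close>

definition q00 :: "real \<Rightarrow> real ^ 'n::finite \<Rightarrow> real ^ 'n \<Rightarrow> real" where
  "q00 c u1 u2 =
     (let V = matrix_inv (two_step c u1 u2) in (V ** Qstar c ** transpose V) $ None $ None)"

text \<open>Only meaningful for \<open>q00 c u1 u2 > 0\<close>.\<close>

definition dilation :: "real \<Rightarrow> real ^ 'n::finite \<Rightarrow> real ^ 'n \<Rightarrow> real" where
  "dilation c u1 u2 = 1 / sqrt (q00 c u1 u2)"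

definition composed_velocity :: "real \<Rightarrow> real ^ 'n::finite \<Rightarrow> real ^ 'n \<Rightarrow> real ^ 'n" where
  "composed_velocity c u1 u2 =
     (1 - (u1 \<bullet> u2) / c\<^sup>2) *\<^sub>R u2 + (1 / gam c u2) *\<^sub>R u1
       + ((1 - 1 / gam c u2) * (sgn u2 \<bullet> u1)) *\<^sub>R sgn u2"

section \<open>Two-step rotation\<close>

definition spatial_block :: "real ^ ('n::finite) option ^ 'n option \<Rightarrow> real ^ 'n ^ 'n" where
  "spatial_block W = (\<chi> i j. W $ Some i $ Some j)"

definition pos_def_matrix :: "real ^ 'n ^ ('n::finite) \<Rightarrow> bool" where
  "pos_def_matrix P \<longleftrightarrow> transpose P = P \<and> (\<forall>x. x \<noteq> 0 \<longrightarrow> x \<bullet> (P *v x) > 0)"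

text \<open>The factor \<open>R\<close> of \<open>S = R ** P\<close>; it exists and is unique for invertible \<open>S\<close>.\<close>

definition orthogonal_polar_factor :: "real ^ 'n ^ 'n \<Rightarrow> real ^ 'n ^ ('n::finite)" where
  "orthogonal_polar_factor S =
     (THE R. orthogonal_matrix R \<and> (\<exists>P. pos_def_matrix P \<and> S = R ** P))"

definition two_step_rotation :: "real \<Rightarrow> real ^ 'n \<Rightarrow> real ^ 'n \<Rightarrow> real ^ 'n ^ ('n::finite)" where
  "two_step_rotation c u1 u2 = orthogonal_polar_factor (spatial_block (two_step c u1 u2))"

text \<open>
  Unsigned angle in \<open>[0, \<pi>]\<close> of a rotation of the plane or of 3-space: a rotation by \<open>\<theta>\<close> has
  trace \<open>2 * cos \<theta>\<close> in dimension 2 and \<open>1 + 2 * cos \<theta>\<close> in dimension 3.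
\<close>

definition rotation_angle :: "real ^ 'n ^ ('n::finite) \<Rightarrow> real" where
  "rotation_angle R = arccos ((trace R - (real CARD('n) - 2)) / 2)"

section \<open>One-forms and continuum transport\<close>

text \<open>A one-form assigns to each point \<open>u\<close> a linear functional of the increment.\<close>

definition freq_form :: "real \<Rightarrow> real ^ 'n::finite \<Rightarrow> real ^ 'n \<Rightarrow> real" where
  "freq_form c u = frechet_derivative (\<lambda>h. ln (dilation c u h)) (at 0)"

definition exact_form_on ::
    "'a::real_normed_vector set \<Rightarrow> ('a \<Rightarrow> 'a \<Rightarrow> real) \<Rightarrow> bool" where
  "exact_form_on S \<omega> \<longleftrightarrow> (\<exists>f. \<forall>u\<in>S. (f has_derivative \<omega> u) (at u))"

definition has_line_integral ::
    "('a::real_normed_vector \<Rightarrow> 'a \<Rightarrow> real) \<Rightarrow> real \<Rightarrow> (real \<Rightarrow> 'a) \<Rightarrow> bool" where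
  "has_line_integral \<omega> I p \<longleftrightarrow>
     ((\<lambda>t. \<omega> (p t) (vector_derivative p (at t within {0..1}))) has_integral I) {0..1}"

definition line_integral ::
    "('a::real_normed_vector \<Rightarrow> 'a \<Rightarrow> real) \<Rightarrow> (real \<Rightarrow> 'a) \<Rightarrow> real" where
  "line_integral \<omega> p =
     integral {0..1} (\<lambda>t. \<omega> (p t) (vector_derivative p (at t within {0..1})))"

definition transport_factor :: "real \<Rightarrow> (real \<Rightarrow> real ^ 'n::finite) \<Rightarrow> real" where
  "transport_factor c p = exp (line_integral (freq_form c) p)"

text \<open>
  \<open>\<theta> u h\<close> is the rotation angle of the step with increment \<open>h\<close> at base point \<open>u\<close>.
\<close>

definition continuum_flat ::
    "'a::real_normed_vector set \<Rightarrow> ('a \<Rightarrow> 'a \<Rightarrow> real) \<Rightarrow> ('a \<Rightarrow> 'a \<Rightarrow> real) \<Rightarrow> bool" where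
  "continuum_flat S \<omega> \<theta> \<longleftrightarrow>
     (\<forall>p. valid_path p \<and> path_image p \<subseteq> S \<and> pathfinish p = pathstart p
        \<longrightarrow> has_line_integral \<omega> 0 p) \<and>
     (\<forall>u\<in>S. (\<lambda>h. \<theta> u h) \<in> O[at 0](\<lambda>h. (norm h)\<^sup>2))"

text \<open>The ordered product \<open>R (N - 1) ** \<dots> ** R 0\<close>.\<close>

definition accumulated :: "(nat \<Rightarrow> real ^ 'n ^ 'n) \<Rightarrow> nat \<Rightarrow> real ^ 'n ^ ('n::finite)" where
  "accumulated R N = fold (\<lambda>k M. R k ** M) [0..<N] (mat 1)"

end

theory Submission
  imports Defs
begin

text \<open>
  A step is block triangular: its time row is \<open>(1/\<gamma>, \<gamma> v\<^sup>T/c\<^sup>2)\<close> and its spatial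
  block stretches by \<open>\<gamma>\<close> along \<open>v\<close>. Reading off the time row of the inverse of a two-step product gives both
  \<open>q\<^sub>0\<^sub>0 = \<gamma>\<^sub>1\<^sup>2 \<gamma>\<^sub>2\<^sup>2 (1 - |w|\<^sup>2/c\<^sup>2)\<close> and
  \<open>q\<^sub>0\<^sub>0 = \<gamma>\<^sub>1\<^sup>2 ((1 - u\<^sub>1 \<bullet> u\<^sub>2/c\<^sup>2)\<^sup>2 - |u\<^sub>1|\<^sup>2/c\<^sup>2)\<close>; the latter
  is quadratic in the second step, so the frequency form is the differential of \<open>ln \<gamma>\<close>.

  For the rotation, the spatial block is a product of two stretches, and the one of the small step
  is the identity plus \<open>\<gamma>(h) - 1 = O(|h|\<^sup>2)\<close> times a rank one matrix. The orthogonal polar factor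
  \<open>R\<close> of \<open>S\<close> maximizes the trace of \<open>R\<^sup>T S\<close> among orthogonal matrices; this gives existence of the
  polar decomposition by compactness and bounds \<open>R - 1\<close> in the Frobenius norm by the perturbation.
\<close>

text \<open>Closes the first-order perturbation arguments: dividing an inequality by the small
  parameter \<open>e\<close> leaves exactly this hypothesis.\<close>

lemma nonpos_if_le_small_multiples:
  fixes d K :: real
  assumes "\<And>e. e > 0 \<Longrightarrow> d \<le> e * K"
  shows "d \<le> 0"
proof (rule field_le_epsilon)
  fix e :: real assume e: "e > 0"
  have "d \<le> (e / (\<bar>K\<bar> + 1)) * K"
    using e by (intro assms) (auto intro!: divide_pos_pos)
  also have "\<dots> \<le> (e / (\<bar>K\<bar> + 1)) * (\<bar>K\<bar> + 1)"
    using e by (intro mult_left_mono) auto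
  finally show "d \<le> 0 + e" by simp
qed

section \<open>The Frobenius inner product\<close>

text \<open>On nested vectors \<open>\<bullet>\<close> is the Frobenius product tr(A^T C), under
  which left multiplication by the transpose is adjoint to left multiplication. This moves
  orthogonal factors across the pairing.\<close>

lemma inner_matrix_mult_left:
  fixes A :: "real ^ 'm ^ 'n" and B :: "real ^ 'k ^ 'm"
  shows "(A ** B) \<bullet> C = B \<bullet> (transpose A ** C)"
proof -
  have "(A ** B) \<bullet> C = (\<Sum>i\<in>UNIV. \<Sum>j\<in>UNIV. \<Sum>k\<in>UNIV. A$i$k * B$k$j * C$i$j)"
    by (simp add: inner_vec_def matrix_matrix_mult_def sum_distrib_right)
  also have "\<dots> = (\<Sum>k\<in>UNIV. \<Sum>j\<in>UNIV. \<Sum>i\<in>UNIV. A$i$k * B$k$j * C$i$j)"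
    by (subst sum.swap, subst (2) sum.swap, subst sum.swap, rule refl)
  also have "\<dots> = B \<bullet> (transpose A ** C)"
    by (simp add: inner_vec_def matrix_matrix_mult_def transpose_def sum_distrib_left mult_ac)
  finally show ?thesis .
qed

lemma matrix_mult_diff_left:
  "A ** (B - C) = A ** B - A ** (C :: real ^ 'k ^ 'm)" for A :: "real ^ 'm ^ 'n"
  by (simp add: matrix_eq matrix_vector_mul_assoc[symmetric] matrix_vector_mult_diff_rdistrib
      matrix_vector_mult_diff_distrib)

lemma matrix_mult_diff_right:
  "(A - B) ** C = A ** C - B ** (C :: real ^ 'k ^ 'm)" for A :: "real ^ 'm ^ 'n"
  by (simp add: matrix_eq matrix_vector_mul_assoc[symmetric] matrix_vector_mult_diff_rdistrib)

lemma inner_transpose_transpose: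
  "transpose A \<bullet> transpose B = A \<bullet> (B :: real ^ 'm ^ 'n)"
  unfolding inner_vec_def transpose_def by (simp, rule sum.swap)

lemma trace_eq_inner: "trace A = mat 1 \<bullet> (A :: real ^ 'n ^ 'n)"
proof -
  have "mat 1 $ i \<bullet> A $ i = A $ i $ i" for i
    by (simp add: inner_vec_def mat_def if_distrib[of "\<lambda>x. x * _"] cong: if_cong)
  then show ?thesis
    by (simp add: trace_def inner_vec_def[of "mat 1"])
qed

text \<open>Left multiplication acts on each column separately, so definiteness of \<open>P\<close>
  on vectors carries over to matrices.\<close>

lemma inner_self_mult_eq_columns:
  fixes P D :: "real ^ 'n ^ 'n"
  shows "D \<bullet> (P ** D) = (\<Sum>j\<in>UNIV. column j D \<bullet> (P *v column j D))"
  unfolding inner_vec_def matrix_matrix_mult_def matrix_vector_mult_def column_def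
  by (simp, rule sum.swap)

lemma inner_self_columns:
  fixes D :: "real ^ 'n ^ 'n"
  shows "D \<bullet> D = (\<Sum>j\<in>UNIV. column j D \<bullet> column j D)"
  using inner_self_mult_eq_columns[of D "mat 1"] by simp

lemma norm_orthogonal_matrix_mult:
  fixes R :: "real ^ 'n ^ 'n" and A :: "real ^ 'm ^ 'n"
  assumes "orthogonal_matrix R"
  shows "norm (R ** A) = norm A"
  using assms
  by (simp add: norm_eq_sqrt_inner inner_matrix_mult_left matrix_mul_assoc orthogonal_matrix_def)

section \<open>Rank one matrices and reflections\<close>

definition outer :: "real ^ 'm \<Rightarrow> real ^ 'n \<Rightarrow> real ^ 'n ^ 'm" where
  "outer a b = (\<chi> i j. a $ i * b $ j)"

lemma outer_vector_mult: "outer a b *v x = (b \<bullet> x) *\<^sub>R a"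
  by (simp add: vec_eq_iff outer_def matrix_vector_mult_def inner_vec_def sum_distrib_left
      sum_distrib_right mult_ac)

lemma inner_outer: "outer a b \<bullet> M = a \<bullet> (M *v b)"
  by (simp add: outer_def matrix_vector_mult_def inner_vec_def sum_distrib_left mult_ac)

lemma norm_outer: "norm (outer a b) = norm a * norm b"
  by (simp add: norm_eq_sqrt_inner inner_outer outer_vector_mult real_sqrt_mult mult_ac)

lemma transpose_outer: "transpose (outer a b) = outer b a"
  by (simp add: outer_def transpose_def vec_eq_iff)

lemma transpose_add: "transpose (A + B) = transpose A + transpose (B :: real ^ 'm ^ 'n)"
  by (simp add: transpose_def vec_eq_iff)

lemma transpose_diff: "transpose (A - B) = transpose A - transpose (B :: real ^ 'm ^ 'n)"
  by (simp add: transpose_def vec_eq_iff)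

lemma transpose_scaleR: "transpose (k *\<^sub>R A) = k *\<^sub>R transpose (A :: real ^ 'm ^ 'n)"
  by (simp add: transpose_def vec_eq_iff)

lemma matrix_scaleR_vector_mult: "(k *\<^sub>R A) *v x = k *\<^sub>R (A *v (x :: real ^ 'n))"
  by (simp add: scaleR_matrix_vector_assoc)

text \<open>Reflections and products of two of them are the competitors in the trace maximization
  below; no matrix exponentials or angles are involved.\<close>

definition householder :: "real ^ 'n \<Rightarrow> real ^ 'n ^ 'n" where
  "householder a = mat 1 - (2 / (a \<bullet> a)) *\<^sub>R outer a a"

lemma householder_vector_mult: "householder a *v x = x - (2 * (a \<bullet> x) / (a \<bullet> a)) *\<^sub>R a"
  by (simp add: householder_def matrix_vector_mult_diff_rdistrib matrix_scaleR_vector_mult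
      outer_vector_mult)

lemma orthogonal_householder:
  assumes "a \<noteq> 0"
  shows "orthogonal_matrix (householder a)"
proof -
  have t: "transpose (householder a) = householder a"
    by (simp add: householder_def transpose_diff transpose_scaleR transpose_outer transpose_mat)
  have "a \<bullet> a \<noteq> 0" using assms by simp
  then have "householder a ** householder a = mat 1"
    by (simp add: matrix_eq matrix_vector_mul_assoc[symmetric] householder_vector_mult
        inner_diff_right field_simps)
  then show ?thesis
    by (simp add: orthogonal_matrix t)
qed

text \<open>Written so that \<open>inner_outer\<close> evaluates the pairing with a matrix; the
  non-symmetric term \<open>outer a b\<close> is the one that sees an antisymmetric part.\<close>

lemma householder_mult:
  assumes "a \<noteq> 0" "b \<noteq> 0"
  shows "householder a ** householder b = mat 1 - (2 / (a \<bullet> a)) *\<^sub>R outer a a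
     - (2 / (b \<bullet> b)) *\<^sub>R outer b b + (4 * (a \<bullet> b) / ((a \<bullet> a) * (b \<bullet> b))) *\<^sub>R outer a b"
  by (simp add: matrix_eq matrix_vector_mul_assoc[symmetric] householder_vector_mult
      matrix_vector_mult_diff_rdistrib matrix_vector_mult_add_rdistrib matrix_scaleR_vector_mult
      outer_vector_mult inner_diff_right scaleR_diff_left diff_divide_distrib algebra_simps)

section \<open>Polar decomposition\<close>

text \<open>Closed, being cut out by polynomial equations in the entries; bounded, since every
  orthogonal matrix has the Frobenius norm of the identity.\<close>

lemma compact_orthogonal_matrices: "compact {Q :: real ^ 'n ^ 'n. orthogonal_matrix Q}"
proof -
  have "{Q :: real ^ 'n ^ 'n. orthogonal_matrix Q} =
      {Q. \<forall>i j. (\<Sum>k\<in>UNIV. Q $ k $ i * Q $ k $ j) = mat 1 $ i $ j}"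
    by (simp add: orthogonal_matrix vec_eq_iff matrix_matrix_mult_def transpose_def)
  then have "closed {Q :: real ^ 'n ^ 'n. orthogonal_matrix Q}"
    by (auto intro!: closed_Collect_all closed_Collect_eq continuous_intros)
  moreover have "norm Q \<le> norm (mat 1 :: real ^ 'n ^ 'n)" if "orthogonal_matrix Q"
    for Q :: "real ^ 'n ^ 'n"
    using norm_orthogonal_matrix_mult[OF that, of "mat 1"] by simp
  ultimately show ?thesis
    by (auto simp: compact_eq_bounded_closed bounded_iff)
qed

text \<open>Replacing the identity by the reflection along \<open>x\<close> changes the pairing by
  -2 (x . P x) / (x . x), which maximality forces to be nonpositive.\<close>

lemma psd_if_trace_maximal:
  fixes P :: "real ^ 'n ^ 'n"
  assumes max: "\<And>Q. orthogonal_matrix Q \<Longrightarrow> Q \<bullet> P \<le> mat 1 \<bullet> P"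
  shows "0 \<le> x \<bullet> (P *v x)"
proof (cases "x = 0")
  case False
  have "householder x \<bullet> P \<le> mat 1 \<bullet> P"
    by (intro max orthogonal_householder False)
  then have "0 \<le> (2 / (x \<bullet> x)) * (x \<bullet> (P *v x))"
    by (simp add: householder_def inner_diff_left inner_outer)
  moreover have "x \<bullet> x > 0" using False by simp
  ultimately show ?thesis
    by (simp add: zero_le_divide_iff)
qed simp

text \<open>
  A product of two reflections in nearly parallel directions is an infinitesimal rotation;
  maximality along it kills the antisymmetric part of \<open>P\<close>.
\<close>
lemma symmetric_if_trace_maximal:
  fixes P :: "real ^ 'n ^ 'n"
  assumes max: "\<And>Q. orthogonal_matrix Q \<Longrightarrow> Q \<bullet> P \<le> mat 1 \<bullet> P"
  shows "transpose P = P"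
proof -
  have le: "P $ i $ j \<le> P $ j $ i" if "i \<noteq> j" for i j
  proof -
    define e f where "e = (axis i 1 :: real ^ 'n)" and "f = (axis j 1 :: real ^ 'n)"
    have ef: "e \<bullet> e = 1" "f \<bullet> f = 1" "e \<bullet> f = 0" "f \<bullet> e = 0"
      using that by (auto simp: e_def f_def inner_axis_axis)
    have P: "e \<bullet> (P *v f) = P $ i $ j" "f \<bullet> (P *v e) = P $ j $ i"
      by (simp_all add: e_def f_def inner_axis' matrix_vector_mult_basis column_def)
    \<comment> \<open>Up to a common factor 2, the second-order coefficient in the maximality
      inequality below.\<close>
    define K where "K = e \<bullet> (P *v e) + f \<bullet> (P *v f)"
    have "P $ i $ j - P $ j $ i \<le> \<epsilon> * K" if \<epsilon>: "\<epsilon> > 0" for \<epsilon>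
    proof -
      define b where "b = e + \<epsilon> *\<^sub>R f"
      have bb: "b \<bullet> b = 1 + \<epsilon>\<^sup>2" and eb: "e \<bullet> b = 1"
        by (simp_all add: b_def inner_add_left inner_add_right ef power2_eq_square)
      have pos: "1 + \<epsilon>\<^sup>2 > 0" by (simp add: add_pos_nonneg)
      have nz: "e \<noteq> 0" "b \<noteq> 0" using ef(1) bb pos by force+
      have ePb: "e \<bullet> (P *v b) = e \<bullet> (P *v e) + \<epsilon> * P $ i $ j"
        by (simp add: b_def matrix_vector_right_distrib matrix_vector_mult_scaleR inner_add_right P)
      have bPb: "b \<bullet> (P *v b) = e \<bullet> (P *v e) + \<epsilon> * (P $ i $ j + P $ j $ i) + \<epsilon>\<^sup>2 * (f \<bullet> (P *v f))"
        by (simp add: b_def matrix_vector_right_distrib matrix_vector_mult_scaleR inner_add_right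
            inner_add_left P algebra_simps power2_eq_square)
      \<comment> \<open>A rotation in the plane of \<open>e\<close> and \<open>f\<close> by twice
        the small angle between \<open>e\<close> and \<open>b\<close>. The terms of order zero
        cancel, so the antisymmetric part of \<open>P\<close> leads, at order
        \<open>\<epsilon>\<close>.\<close>
      have "(householder e ** householder b) \<bullet> P \<le> mat 1 \<bullet> P"
        by (intro max orthogonal_matrix_mul orthogonal_householder nz)
      then have "4 * (e \<bullet> (P *v b)) / (1 + \<epsilon>\<^sup>2)
          \<le> 2 * (e \<bullet> (P *v e)) + 2 * (b \<bullet> (P *v b)) / (1 + \<epsilon>\<^sup>2)"
        by (simp add: householder_mult[OF nz] inner_diff_left inner_add_left inner_outer bb eb ef)
      then have "4 * (e \<bullet> (P *v b)) \<le> 2 * (e \<bullet> (P *v e)) * (1 + \<epsilon>\<^sup>2) + 2 * (b \<bullet> (P *v b))"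
        using pos by (simp add: pos_divide_le_eq distrib_right)
      then have "\<epsilon> * (P $ i $ j - P $ j $ i) \<le> \<epsilon> * (\<epsilon> * K)"
        unfolding ePb bPb K_def by (simp add: algebra_simps power2_eq_square)
      then show ?thesis using \<epsilon> by simp
    qed
    then have "P $ i $ j - P $ j $ i \<le> 0"
      by (rule nonpos_if_le_small_multiples)
    then show ?thesis by simp
  qed
  have "P $ i $ j = P $ j $ i" for i j
    using le[of i j] le[of j i] by (cases "i = j") auto
  then show ?thesis
    by (simp add: transpose_def vec_eq_iff)
qed

lemma inner_symmetric_matrix:
  assumes "transpose P = P"
  shows "x \<bullet> (P *v y) = (P *v x) \<bullet> (y :: real ^ 'n)"
  using assms by (metis dot_lmul_matrix transpose_matrix_vector)

text \<open>A zero of the form is a minimum, yet moving from \<open>x\<close> by a small multiple e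
  of \<open>- (P *v x)\<close> changes the form by -2 e |P x|^2 + O(e^2).\<close>

lemma psd_null_vector:
  fixes P :: "real ^ 'n ^ 'n"
  assumes sym: "transpose P = P" and psd: "\<And>x. 0 \<le> x \<bullet> (P *v x)" and x: "x \<bullet> (P *v x) = 0"
  shows "P *v x = 0"
proof -
  define y where "y = P *v x"
  have "2 * (y \<bullet> y) \<le> \<epsilon> * (y \<bullet> (P *v y))" if \<epsilon>: "\<epsilon> > 0" for \<epsilon>
  proof -
    have "x \<bullet> (P *v y) = y \<bullet> y"
      using inner_symmetric_matrix[OF sym] by (simp add: y_def)
    then have "0 \<le> \<epsilon> * (\<epsilon> * (y \<bullet> (P *v y)) - 2 * (y \<bullet> y))"
      using psd[of "x - \<epsilon> *\<^sub>R y"] x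
      by (simp add: matrix_vector_mult_diff_distrib matrix_vector_mult_scaleR inner_diff_left
          inner_diff_right y_def[symmetric] algebra_simps)
    then show ?thesis using \<epsilon> by (simp add: zero_le_mult_iff)
  qed
  then have "2 * (y \<bullet> y) \<le> 0"
    by (rule nonpos_if_le_small_multiples)
  moreover have "0 \<le> y \<bullet> y" by simp
  ultimately have "y \<bullet> y = 0" by linarith
  then show ?thesis by (simp add: y_def)
qed

text \<open>Compactness yields an orthogonal \<open>R\<close> maximizing
  \<open>R \<bullet> S\<close>. Maximality makes R^T S symmetric and semidefinite, and invertibility
  of \<open>S\<close> excludes null vectors.\<close>

lemma polar_decomposition_exists:
  fixes S :: "real ^ 'n ^ 'n"
  assumes "invertible S"
  shows "\<exists>R P. orthogonal_matrix R \<and> pos_def_matrix P \<and> S = R ** P"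
proof -
  have "\<exists>R\<in>{Q :: real ^ 'n ^ 'n. orthogonal_matrix Q}.
      \<forall>Q\<in>{Q. orthogonal_matrix Q}. Q \<bullet> S \<le> R \<bullet> S"
    by (intro continuous_attains_sup compact_orthogonal_matrices continuous_intros)
      (use orthogonal_matrix_id in auto)
  then obtain R where R: "orthogonal_matrix R"
    and sup: "\<And>Q. orthogonal_matrix Q \<Longrightarrow> Q \<bullet> S \<le> R \<bullet> S" by auto
  define P where "P = transpose R ** S"
  have S: "S = R ** P"
    using R by (simp add: P_def matrix_mul_assoc orthogonal_matrix_def)
  \<comment> \<open>Left translation by \<open>R\<close> maps orthogonal matrices to orthogonal
    ones, so maximality of \<open>R\<close> against \<open>S\<close> becomes maximality of the
    identity against \<open>P\<close>.\<close>
  have max: "Q \<bullet> P \<le> mat 1 \<bullet> P" if "orthogonal_matrix Q" for Q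
    using sup[OF orthogonal_matrix_mul[OF R that]]
      inner_matrix_mult_left[of R Q S] inner_matrix_mult_left[of R "mat 1" S]
    by (simp add: P_def)
  note sym = symmetric_if_trace_maximal[OF max]
  note psd = psd_if_trace_maximal[OF max]
  have "x \<bullet> (P *v x) > 0" if "x \<noteq> 0" for x
  proof (rule ccontr)
    assume "\<not> x \<bullet> (P *v x) > 0"
    then have "P *v x = 0"
      using psd[of x] by (intro psd_null_vector sym psd) auto
    then have "S *v x = 0"
      by (simp add: S matrix_vector_mul_assoc[symmetric])
    moreover obtain T where "T ** S = mat 1"
      using assms by (auto simp: invertible_def)
    ultimately show False
      using that by (metis matrix_vector_mul_assoc matrix_vector_mul_lid matrix_vector_mult_0_right)
  qed
  then show ?thesis
    using R S sym by (auto simp: pos_def_matrix_def)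
qed

lemma pos_def_inner_mult_pos:
  fixes P D :: "real ^ 'n ^ 'n"
  assumes P: "pos_def_matrix P" and D: "D \<noteq> 0"
  shows "D \<bullet> (P ** D) > 0"
proof -
  obtain j where j: "column j D \<noteq> 0"
    using D by (auto simp: column_def vec_eq_iff)
  have nonneg: "column i D \<bullet> (P *v column i D) \<ge> 0" for i
    using P by (cases "column i D = 0") (auto simp: pos_def_matrix_def less_imp_le)
  show ?thesis
    unfolding inner_self_mult_eq_columns
    by (rule sum_pos2[of _ j]) (use P j nonneg in \<open>auto simp: pos_def_matrix_def\<close>)
qed

text \<open>The segment from the identity to \<open>P\<close> consists of positive definite
  matrices, so the determinant cannot vanish on it and keeps its sign.\<close>

lemma pos_def_det_pos:
  fixes P :: "real ^ 'n ^ 'n"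
  assumes P: "pos_def_matrix P"
  shows "det P > 0"
proof (rule ccontr)
  define f where "f t = det ((1 - t) *\<^sub>R mat 1 + t *\<^sub>R P)" for t :: real
  assume "\<not> det P > 0"
  then have "f 1 \<le> 0" "0 \<le> f 0" by (simp_all add: f_def)
  moreover have "continuous_on {0..1} f"
    unfolding f_def det_def by (auto intro!: continuous_intros)
  ultimately obtain t where t: "0 \<le> t" "t \<le> 1" "f t = 0"
    using IVT2'[of f 1 0 0] by auto
  then obtain x where x: "x \<noteq> 0" "((1 - t) *\<^sub>R mat 1 + t *\<^sub>R P) *v x = 0"
    by (metis f_def invertible_det_nz invertible_left_inverse matrix_left_invertible_ker)
  have "0 = x \<bullet> (((1 - t) *\<^sub>R mat 1 + t *\<^sub>R P) *v x)"
    using x by simp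
  also have "\<dots> = (1 - t) * (x \<bullet> x) + t * (x \<bullet> (P *v x))"
    by (simp add: matrix_vector_mult_add_rdistrib matrix_scaleR_vector_mult inner_add_right)
  finally have "(1 - t) * (x \<bullet> x) + t * (x \<bullet> (P *v x)) = 0" by simp
  moreover have "x \<bullet> x > 0" "x \<bullet> (P *v x) > 0"
    using P x by (auto simp: pos_def_matrix_def)
  ultimately show False
    using t by (smt (verit) mult_nonneg_nonneg mult_pos_pos)
qed

text \<open>Both positive factors have the same square S^T S, so it remains to see that a positive
  definite square root is unique; a Sylvester equation for the difference shows this.\<close>

lemma polar_factor_unique:
  fixes R R' P P' :: "real ^ 'n ^ 'n"
  assumes R: "orthogonal_matrix R" "orthogonal_matrix R'"
    and P: "pos_def_matrix P" "pos_def_matrix P'" and eq: "R ** P = R' ** P'"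
  shows "R = R'"
proof -
  have sym: "transpose P = P" "transpose P' = P'"
    using P by (auto simp: pos_def_matrix_def)
  have square: "transpose (Q ** A) ** (Q ** A) = A ** A"
    if "orthogonal_matrix Q" "transpose A = A" for Q A :: "real ^ 'n ^ 'n"
    using that unfolding orthogonal_matrix_def matrix_transpose_mul
    by (metis matrix_mul_assoc matrix_mul_lid)
  have PP: "P ** P = P' ** P'"
    using square[OF R(1) sym(1)] square[OF R(2) sym(2)] eq by simp
  define D where "D = P - P'"
  have D: "transpose D = D" by (simp add: D_def transpose_diff sym)
  \<comment> \<open>The mixed products cancel although \<open>P\<close> and \<open>P'\<close> need
    not commute. Pairing with \<open>D\<close> then gives two terms, each positive unless
    \<open>D = 0\<close>.\<close>
  have "P ** D + D ** P' = 0"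
    by (simp add: D_def matrix_mult_diff_left matrix_mult_diff_right PP)
  then have "D \<bullet> (P ** D) + D \<bullet> (D ** P') = 0"
    by (simp add: inner_add_right[symmetric])
  moreover have "D \<bullet> (D ** P') = D \<bullet> (P' ** D)"
    using inner_transpose_transpose[of D "D ** P'"] by (simp add: matrix_transpose_mul D sym)
  ultimately have "D = 0"
    using pos_def_inner_mult_pos[OF P(1), of D] pos_def_inner_mult_pos[OF P(2), of D]
    by (cases "D = 0") auto
  then have "R ** P = R' ** P" using eq by (simp add: D_def)
  moreover obtain T where "P ** T = mat 1"
    using pos_def_det_pos[OF P(1)] by (metis invertible_def invertible_det_nz less_irrefl)
  ultimately show ?thesis
    by (metis matrix_mul_assoc matrix_mul_rid)
qed

text \<open>Existence and uniqueness make the definite description denote.\<close>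

lemma orthogonal_polar_factor_props:
  fixes S :: "real ^ 'n ^ 'n"
  assumes "invertible S"
  shows "orthogonal_matrix (orthogonal_polar_factor S)"
    and "\<exists>P. pos_def_matrix P \<and> S = orthogonal_polar_factor S ** P"
proof -
  have "\<exists>!R. orthogonal_matrix R \<and> (\<exists>P. pos_def_matrix P \<and> S = R ** P)"
    using polar_decomposition_exists[OF assms] polar_factor_unique by metis
  from theI'[OF this] show "orthogonal_matrix (orthogonal_polar_factor S)"
    and "\<exists>P. pos_def_matrix P \<and> S = orthogonal_polar_factor S ** P"
    unfolding orthogonal_polar_factor_def by auto
qed

text \<open>Expand and use R . (R P) = tr P by orthogonality and tr(R P) = R . P by symmetry. The
  left side is a weighted squared distance from the identity, so this both estimates that distance
  and shows that the identity maximizes the trace pairing.\<close>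

lemma orthogonal_minus_id_inner:
  fixes R P :: "real ^ 'n ^ 'n"
  assumes R: "orthogonal_matrix R" and P: "transpose P = P"
  shows "transpose (R - mat 1) \<bullet> (P ** transpose (R - mat 1)) = 2 * (mat 1 \<bullet> P - R \<bullet> P)"
proof -
  have "transpose (R - mat 1) \<bullet> (P ** transpose (R - mat 1)) = (R - mat 1) \<bullet> ((R - mat 1) ** P)"
    using inner_transpose_transpose[of "R - mat 1" "(R - mat 1) ** P"]
    by (simp add: matrix_transpose_mul P)
  also have "\<dots> = R \<bullet> (R ** P) - R \<bullet> P - mat 1 \<bullet> (R ** P) + mat 1 \<bullet> P"
    by (simp add: matrix_mult_diff_right inner_diff_left inner_diff_right)
  also have "R \<bullet> (R ** P) = mat 1 \<bullet> P"
    using R inner_matrix_mult_left[of R "mat 1" "R ** P"]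
    by (simp add: matrix_mul_assoc orthogonal_matrix_def)
  also have "mat 1 \<bullet> (R ** P) = R \<bullet> P"
    using inner_matrix_mult_left[of R P "mat 1"] inner_transpose_transpose[of P R]
    by (simp add: P inner_commute)
  finally show ?thesis by simp
qed

text \<open>
  \<open>R\<close> maximizes the trace pairing with \<open>R ** P\<close> while the identity maximizes the one with
  \<open>B\<close>; comparing the two bounds the distance of \<open>R\<close> from the identity without any a priori
  smallness assumption.
\<close>
lemma polar_factor_near_id:
  fixes R P B :: "real ^ 'n ^ 'n" and s :: "real ^ 'n"
  assumes R: "orthogonal_matrix R" and P: "pos_def_matrix P"
    and B: "transpose B = B" "\<And>x. x \<bullet> x \<le> x \<bullet> (B *v x)" and "e \<ge> 0"
    and eq: "(mat 1 + e *\<^sub>R outer s s) ** B = R ** P"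
  shows "norm (R - mat 1) \<le> 2 * e * norm s * norm (B *v s)"
proof -
  define X where "X = R - mat 1"
  have S: "R ** P = B + e *\<^sub>R outer s (B *v s)"
    unfolding eq[symmetric]
    by (simp add: matrix_eq matrix_vector_mul_assoc[symmetric] matrix_vector_mult_add_rdistrib
        matrix_scaleR_vector_mult outer_vector_mult inner_symmetric_matrix[OF B(1)])
  have "norm X ^ 2 = transpose X \<bullet> transpose X"
    by (simp add: inner_transpose_transpose power2_norm_eq_inner)
  \<comment> \<open>As \<open>B\<close> dominates the identity, weighting with it only enlarges the
    norm, column by column.\<close>
  also have "\<dots> \<le> transpose X \<bullet> (B ** transpose X)"
    unfolding inner_self_columns inner_self_mult_eq_columns by (intro sum_mono B)
  also have "\<dots> = 2 * (mat 1 \<bullet> B - R \<bullet> B)"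
    unfolding X_def by (intro orthogonal_minus_id_inner R B)
  \<comment> \<open>Maximality for \<open>P\<close> reads tr(R P) <= R . (R P). Inserting R P = B +
    e s (B s)^T bounds the trace deficit of \<open>B\<close> by the perturbation paired with
    \<open>X\<close>.\<close>
  also have "\<dots> \<le> 2 * (e * (X \<bullet> outer s (B *v s)))"
  proof -
    have sym: "transpose P = P" using P by (simp add: pos_def_matrix_def)
    have "0 \<le> transpose X \<bullet> (P ** transpose X)"
      using pos_def_inner_mult_pos[OF P, of "transpose X"] by (cases "transpose X = 0") auto
    then have "R \<bullet> P \<le> mat 1 \<bullet> P"
      unfolding X_def orthogonal_minus_id_inner[OF R sym] by simp
    moreover have "R \<bullet> P = mat 1 \<bullet> (R ** P)"
      using inner_matrix_mult_left[of R P "mat 1"] inner_transpose_transpose[of P R]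
      by (simp add: sym inner_commute)
    moreover have "mat 1 \<bullet> P = R \<bullet> (R ** P)"
      using R inner_matrix_mult_left[of R "mat 1" "R ** P"]
      by (simp add: matrix_mul_assoc orthogonal_matrix_def)
    ultimately have "mat 1 \<bullet> (R ** P) \<le> R \<bullet> (R ** P)" by simp
    then show ?thesis
      unfolding S X_def by (simp add: inner_diff_left inner_add_right algebra_simps)
  qed
  also have "\<dots> \<le> 2 * (e * (norm X * (norm s * norm (B *v s))))"
    using norm_cauchy_schwarz[of X "outer s (B *v s)"] \<open>e \<ge> 0\<close>
    by (auto simp: norm_outer intro!: mult_left_mono)
  \<comment> \<open>One factor \<open>norm X\<close> cancels, so the final bound is linear in
    \<open>e\<close> instead of of order sqrt(e).\<close>
  finally have "norm X * norm X \<le> norm X * (2 * e * norm s * norm (B *v s))"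
    by (simp add: power2_eq_square mult_ac)
  then show ?thesis
    unfolding X_def[symmetric] using \<open>e \<ge> 0\<close>
    by (cases "norm X = 0") (simp_all add: mult_le_cancel_left)
qed

section \<open>Angles of rotations close to the identity\<close>

text \<open>Integrate cos >= 1/2 twice on [0,1], an interval below pi/3. The constant 1/4 fits |R -
  1|^2 = 4 (1 - cos theta), so that the rotation angle is at most the Frobenius distance.\<close>

lemma cos_le_one_minus_quarter_square:
  fixes y :: real
  assumes "0 \<le> y" "y \<le> 1"
  shows "cos y \<le> 1 - y\<^sup>2 / 4"
proof -
  have c: "cos x \<ge> 1 / 2" if "0 \<le> x" "x \<le> 1" for x :: real
    using cos_monotone_0_pi_le[of x "pi / 3"] that pi_gt3 by (simp add: cos_60)
  have s: "x / 2 \<le> sin x" if "0 \<le> x" "x \<le> 1" for x :: real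
  proof -
    have "sin 0 - 0 / 2 \<le> sin x - x / 2"
    proof (rule DERIV_nonneg_imp_nondecreasing[OF \<open>0 \<le> x\<close>])
      fix z :: real assume "0 \<le> z" "z \<le> x"
      then show "\<exists>y. ((\<lambda>x. sin x - x / 2) has_real_derivative y) (at z) \<and> 0 \<le> y"
        using c[of z] that by (intro exI[of _ "cos z - 1 / 2"]) (auto intro!: derivative_eq_intros)
    qed
    then show ?thesis by simp
  qed
  have "1 - 0\<^sup>2 / 4 - cos 0 \<le> 1 - y\<^sup>2 / 4 - cos y"
  proof (rule DERIV_nonneg_imp_nondecreasing[OF \<open>0 \<le> y\<close>])
    fix z :: real assume "0 \<le> z" "z \<le> y"
    then show "\<exists>y. ((\<lambda>x. 1 - x\<^sup>2 / 4 - cos x) has_real_derivative y) (at z) \<and> 0 \<le> y"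
      using s[of z] assms by (intro exI[of _ "sin z - z / 2"]) (auto intro!: derivative_eq_intros)
  qed
  then show ?thesis by simp
qed

lemma rotation_angle_bounds:
  fixes R :: "real ^ 'n ^ 'n"
  assumes R: "orthogonal_matrix R" and near: "norm (R - mat 1) \<le> 1"
  shows "0 \<le> rotation_angle R" "rotation_angle R \<le> norm (R - mat 1)"
proof -
  define y where "y = norm (R - mat 1)"
  have "y\<^sup>2 = R \<bullet> R - 2 * (mat 1 \<bullet> R) + mat 1 \<bullet> (mat 1 :: real ^ 'n ^ 'n)"
    unfolding y_def power2_norm_eq_inner
    by (simp add: inner_diff_left inner_diff_right inner_commute)
  moreover have "R \<bullet> R = mat 1 \<bullet> (mat 1 :: real ^ 'n ^ 'n)"
    using R inner_matrix_mult_left[of R "mat 1" R] by (simp add: orthogonal_matrix_def)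
  moreover have "mat 1 \<bullet> (mat 1 :: real ^ 'n ^ 'n) = CARD('n)"
    by (simp add: trace_eq_inner[symmetric] trace_I)
  ultimately have "(mat 1 \<bullet> R - (real CARD('n) - 2)) / 2 = 1 - y\<^sup>2 / 4"
    by (simp add: field_simps)
  then have eq: "rotation_angle R = arccos (1 - y\<^sup>2 / 4)"
    by (simp only: rotation_angle_def trace_eq_inner)
  have y: "0 \<le> y" "y \<le> 1" using near by (simp_all add: y_def)
  then have "y\<^sup>2 \<le> 1" by (simp add: power_le_one)
  then have "\<bar>1 - y\<^sup>2 / 4\<bar> \<le> 1" by simp
  then show "0 \<le> rotation_angle R"
    unfolding eq by (intro arccos_lbound) auto
  have "arccos (1 - y\<^sup>2 / 4) \<le> arccos (cos y)"
    using cos_le_one_minus_quarter_square[OF y] \<open>y\<^sup>2 \<le> 1\<close>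
    by (intro arccos_le_arccos) auto
  also have "\<dots> = y" using y pi_gt3 by (intro arccos_cos) auto
  finally show "rotation_angle R \<le> norm (R - mat 1)"
    by (simp add: eq y_def)
qed

text \<open>Telescoping: R_N M - 1 = R_N (M - 1) + (R_N - 1), and the orthogonal factor R_N
  preserves the norm, so deviations add without amplification.\<close>

lemma norm_accumulated_minus_id_le:
  assumes "\<And>k. k < N \<Longrightarrow> orthogonal_matrix (R k)"
  shows "norm (accumulated R N - mat 1) \<le> (\<Sum>k<N. norm (R k - mat 1))"
  using assms
proof (induction N)
  case 0
  then show ?case by (simp add: accumulated_def)
next
  case (Suc N)
  have "accumulated R (Suc N) - mat 1 = R N ** (accumulated R N - mat 1) + (R N - mat 1)"
    by (simp add: accumulated_def matrix_mult_diff_left)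
  then have "norm (accumulated R (Suc N) - mat 1) \<le>
      norm (R N ** (accumulated R N - mat 1)) + norm (R N - mat 1)"
    by (metis norm_triangle_ineq)
  also have "norm (R N ** (accumulated R N - mat 1)) = norm (accumulated R N - mat 1)"
    using Suc.prems by (intro norm_orthogonal_matrix_mult) auto
  finally show ?case using Suc by simp
qed

section \<open>The block structure of steps\<close>

lemma time_part_event [simp]: "time_part (event t x) = t"
  by (simp add: time_part_def event_def)

lemma space_part_event [simp]: "space_part (event t x) = x"
  by (simp add: space_part_def event_def vec_eq_iff)

lemma event_time_space [simp]: "event (time_part X) (space_part X) = X"
  by (simp add: time_part_def space_part_def event_def vec_eq_iff split: option.split)

lemma linear_time_part: "linear time_part"
  by (rule linearI) (simp_all add: time_part_def)

lemma linear_space_part: "linear space_part"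
  by (rule linearI) (simp_all add: space_part_def vec_eq_iff)

lemma linear_event:
  assumes "linear f" "linear g"
  shows "linear (\<lambda>X. event (f X) (g X))"
  using assms
  by (intro linearI) (auto simp: event_def vec_eq_iff linear_add linear_scale split: option.split)

lemma matrix_event_vector_mult:
  assumes "linear f" "linear g"
  shows "matrix (\<lambda>X. event (f X) (g X)) *v X = event (f X) (g X)"
  using fun_cong[OF matrix_vector_mul(2)[OF linear_event[OF assms]], of X] by simp

lemmas linear_parts_simps =
  linear_add[OF linear_time_part] linear_scale[OF linear_time_part]
  linear_add[OF linear_space_part] linear_scale[OF linear_space_part]

section \<open>Stretches along a direction\<close>

text \<open>Multiplies the component along \<open>v\<close> by \<open>k\<close> and fixes the orthogonal complement.\<close>
definition stretch :: "real \<Rightarrow> real ^ 'n \<Rightarrow> real ^ 'n ^ 'n" where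
  "stretch k v = mat 1 + (k - 1) *\<^sub>R outer (sgn v) (sgn v)"

lemma stretch_vector_mult: "stretch k v *v x = x + ((k - 1) * (sgn v \<bullet> x)) *\<^sub>R sgn v"
  by (simp add: stretch_def matrix_vector_mult_add_rdistrib matrix_scaleR_vector_mult outer_vector_mult)

lemma transpose_stretch: "transpose (stretch k v) = stretch k v"
  by (simp add: stretch_def transpose_add transpose_scaleR transpose_outer transpose_mat)

lemma sgn_inner_sgn: "v \<noteq> 0 \<Longrightarrow> sgn v \<bullet> sgn v = (1 :: real)" for v :: "real ^ 'n"
  by (simp add: norm_sgn flip: power2_norm_eq_inner)

lemma stretch_mult: "stretch k v ** stretch l v = stretch (k * l) v"
proof (cases "v = 0")
  case False
  then show ?thesis
    by (simp add: matrix_eq matrix_vector_mul_assoc[symmetric] stretch_vector_mult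
        inner_add_right sgn_inner_sgn algebra_simps)
qed (simp add: matrix_eq matrix_vector_mul_assoc[symmetric] stretch_vector_mult)

lemma stretch_one [simp]: "stretch 1 v = mat 1"
  by (simp add: stretch_def)

lemma inner_stretch_self: "v \<bullet> (stretch k v *v x) = k * (v \<bullet> x)"
proof (cases "v = 0")
  case False
  have "v = norm v *\<^sub>R sgn v" by (cases "v = 0") (simp_all add: sgn_div_norm)
  then have v: "v \<bullet> y = norm v * (sgn v \<bullet> y)" for y by (metis inner_scaleR_left)
  show ?thesis
    unfolding v by (simp add: stretch_vector_mult inner_add_right sgn_inner_sgn False algebra_simps)
qed simp

lemma inner_stretch: "x \<bullet> (stretch k v *v x) = x \<bullet> x + (k - 1) * (sgn v \<bullet> x)\<^sup>2"
  by (simp add: stretch_vector_mult inner_add_right power2_eq_square inner_commute)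

lemma inner_le_inner_stretch: "1 \<le> k \<Longrightarrow> x \<bullet> x \<le> x \<bullet> (stretch k v *v x)"
  by (simp add: inner_stretch)

lemma pos_def_stretch:
  assumes "k > 0"
  shows "pos_def_matrix (stretch k v)"
proof -
  have "x \<bullet> (stretch k v *v x) > 0" if x: "x \<noteq> 0" for x
  proof (cases "k \<ge> 1")
    case True
    have "0 < x \<bullet> x" using x by simp
    also have "\<dots> \<le> x \<bullet> (stretch k v *v x)" by (rule inner_le_inner_stretch[OF True])
    finally show ?thesis .
  next
    case False
    \<comment> \<open>For \<open>k < 1\<close> the rank one term lowers the form; by Cauchy-Schwarz
      at least k |x|^2 remains.\<close>
    have "\<bar>sgn v \<bullet> x\<bar> \<le> norm (sgn v) * norm x" by (rule Cauchy_Schwarz_ineq2)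
    also have "\<dots> \<le> 1 * norm x" by (intro mult_right_mono) (simp_all add: norm_sgn)
    finally have "(sgn v \<bullet> x)\<^sup>2 \<le> x \<bullet> x"
      by (metis abs_le_square_iff abs_norm_cancel mult_1 power2_norm_eq_inner)
    then have "(k - 1) * (sgn v \<bullet> x)\<^sup>2 \<ge> (k - 1) * (x \<bullet> x)"
      using False by (intro mult_left_mono_neg) auto
    moreover have "k * (x \<bullet> x) > 0" using assms x by simp
    ultimately show ?thesis by (simp add: inner_stretch algebra_simps)
  qed
  then show ?thesis by (simp add: pos_def_matrix_def transpose_stretch)
qed

lemma norm_stretch_vector_le:
  assumes "1 \<le> k"
  shows "norm (stretch k v *v x) \<le> k * norm x"
proof -
  have "norm (stretch k v *v x) \<le> norm x + (k - 1) * (\<bar>sgn v \<bullet> x\<bar> * norm (sgn v))"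
    unfolding stretch_vector_mult using assms
    by (intro order_trans[OF norm_triangle_ineq]) (simp add: abs_mult mult_ac)
  also have "\<bar>sgn v \<bullet> x\<bar> * norm (sgn v) \<le> (norm (sgn v) * norm x) * norm (sgn v)"
    by (intro mult_right_mono Cauchy_Schwarz_ineq2) auto
  also have "\<dots> \<le> norm x" by (simp add: norm_sgn)
  finally have "norm (stretch k v *v x) \<le> norm x + (k - 1) * norm x"
    using assms by (simp add: mult_left_mono)
  then show ?thesis by (simp add: algebra_simps)
qed

section \<open>The Lorentz factor\<close>

lemma gam_args:
  assumes "norm v < c"
  shows "0 < 1 - (norm v)\<^sup>2 / c\<^sup>2" "1 - (norm v)\<^sup>2 / c\<^sup>2 \<le> 1"
proof -
  have "(norm v)\<^sup>2 < c\<^sup>2" using assms by (intro power_strict_mono) auto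
  moreover have "c \<noteq> 0" using assms norm_ge_zero[of v] by linarith
  ultimately show "0 < 1 - (norm v)\<^sup>2 / c\<^sup>2" "1 - (norm v)\<^sup>2 / c\<^sup>2 \<le> 1"
    by simp_all
qed

lemma gam_pos: "norm v < c \<Longrightarrow> 0 < gam c v"
  using gam_args(1)[of v c] by (simp add: gam_def)

lemma gam_ge_1: "norm v < c \<Longrightarrow> 1 \<le> gam c v"
  using gam_args[of v c] by (simp add: gam_def)

lemma gam_square: "norm v < c \<Longrightarrow> (gam c v)\<^sup>2 = 1 / (1 - (norm v)\<^sup>2 / c\<^sup>2)"
  using gam_args(1)[of v c] by (simp add: gam_def power_divide)

lemma gam_square_identity:
  assumes "norm v < c"
  shows "(gam c v)\<^sup>2 - (gam c v)\<^sup>2 * (norm v)\<^sup>2 / c\<^sup>2 = 1"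
proof -
  have "(gam c v)\<^sup>2 - (gam c v)\<^sup>2 * (norm v)\<^sup>2 / c\<^sup>2 = (gam c v)\<^sup>2 * (1 - (norm v)\<^sup>2 / c\<^sup>2)"
    by (simp add: right_diff_distrib)
  also have "\<dots> = 1"
    unfolding gam_square[OF assms] using gam_args(1)[OF assms]
    by (metis less_irrefl nonzero_eq_divide_eq)
  finally show ?thesis .
qed

lemma norm_square_eq_gam: "norm v < c \<Longrightarrow> (norm v)\<^sup>2 / c\<^sup>2 = 1 - 1 / (gam c v)\<^sup>2"
  by (simp add: gam_square)

lemma gam_uminus: "gam c (- v) = gam c v"
  by (simp add: gam_def)

lemma inner_sgn_square: "(sgn v \<bullet> x)\<^sup>2 * (norm v)\<^sup>2 = (v \<bullet> x)\<^sup>2" for v :: "real ^ 'n"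
  by (cases "v = 0") (simp_all add: sgn_div_norm power_mult_distrib field_simps)

section \<open>Block form of boosts and steps\<close>

lemma galilei_vector_mult:
  "galilei v *v X = event (time_part X) (space_part X - time_part X *\<^sub>R v)"
  unfolding galilei_def
  by (rule matrix_event_vector_mult)
    (auto intro!: linearI simp: linear_parts_simps algebra_simps time_part_def)

lemma lorentz_vector_mult:
  "lorentz c v *v X = event (gam c v * (time_part X - (v \<bullet> space_part X) / c\<^sup>2))
     (stretch (gam c v) v *v space_part X - (gam c v * time_part X) *\<^sub>R v)"
  unfolding lorentz_def stretch_vector_mult
  by (rule matrix_event_vector_mult)
    (auto intro!: linearI simp: linear_parts_simps algebra_simps inner_add_right add_divide_distrib)

lemma stretch_uminus: "stretch k (- v) = stretch k v"
  by (simp add: matrix_eq stretch_vector_mult sgn_minus)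

lemma stretch_vector_self: "stretch k v *v v = k *\<^sub>R v"
proof -
  have "sgn v \<bullet> v = norm v"
    by (cases "v = 0") (simp_all add: sgn_div_norm dot_square_norm power2_eq_square)
  then have "(sgn v \<bullet> v) *\<^sub>R sgn v = v"
    by (cases "v = 0") (simp_all add: sgn_div_norm)
  then show ?thesis
    by (simp add: stretch_vector_mult scaleR_diff_left algebra_simps flip: scaleR_scaleR)
qed

text \<open>The stretch turns the Galilei shift -v t into -gamma v t, which cancels the shift of the
  boost by -v; hence the spatial output ignores time. The time coefficient gamma (1 - |v|^2/c^2)
  equals 1/gamma.\<close>

lemma step_vector_mult:
  assumes "norm v < c"
  shows "step c v *v X = event (time_part X / gam c v + gam c v * (v \<bullet> space_part X) / c\<^sup>2)
     (stretch (gam c v) v *v space_part X)"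
proof -
  have pos: "gam c v > 0" using gam_pos[OF assms] .
  have "gam c v - gam c v * (norm v)\<^sup>2 / c\<^sup>2 = 1 / gam c v"
    using gam_square_identity[OF assms] pos by (simp add: field_simps power2_eq_square)
  then have "gam c v * (time_part X + (v \<bullet> (space_part X - time_part X *\<^sub>R v)) / c\<^sup>2)
      = time_part X * (1 / gam c v) + gam c v * (v \<bullet> space_part X) / c\<^sup>2"
    by (simp flip: \<open>_ = 1 / gam c v\<close>)
      (simp add: inner_diff_right power2_norm_eq_inner algebra_simps diff_divide_distrib)
  moreover have "stretch (gam c v) v *v (space_part X - time_part X *\<^sub>R v)
        + (gam c v * time_part X) *\<^sub>R v = stretch (gam c v) v *v space_part X"
    by (simp add: matrix_vector_mult_diff_distrib matrix_vector_mult_scaleR stretch_vector_self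
        mult.commute)
  ultimately show ?thesis
    by (simp add: step_def matrix_vector_mul_assoc[symmetric] galilei_vector_mult
        lorentz_vector_mult gam_uminus stretch_uminus)
qed

text \<open>Solves the block triangular system of \<open>step_vector_mult\<close>: undoing the
  stretch scales v . x by 1/gamma, which makes the time row that of
  \<open>lorentz c v\<close>.\<close>

definition step_inv :: "real \<Rightarrow> real ^ 'n \<Rightarrow> real ^ ('n::finite) option ^ 'n option" where
  "step_inv c v = matrix (\<lambda>X. event (gam c v * (time_part X - (v \<bullet> space_part X) / c\<^sup>2))
     (stretch (1 / gam c v) v *v space_part X))"

lemma step_inv_vector_mult:
  "step_inv c v *v X = event (gam c v * (time_part X - (v \<bullet> space_part X) / c\<^sup>2))
     (stretch (1 / gam c v) v *v space_part X)"
  unfolding step_inv_def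
  by (rule matrix_event_vector_mult)
    (auto intro!: linearI simp: linear_parts_simps algebra_simps inner_add_right add_divide_distrib
      matrix_vector_right_distrib matrix_vector_mult_scaleR)

lemma step_inv_mult_step:
  assumes "norm v < c"
  shows "step_inv c v ** step c v = mat 1"
  using gam_pos[OF assms]
  by (simp add: matrix_eq matrix_vector_mul_assoc[symmetric] step_vector_mult[OF assms]
      step_inv_vector_mult inner_stretch_self right_diff_distrib distrib_left
      matrix_vector_mul_assoc stretch_mult)

lemma matrix_inv_eqI:
  fixes A :: "real ^ 'n ^ 'n"
  assumes "A ** B = mat 1" "B ** A = mat 1"
  shows "matrix_inv A = B"
proof -
  have "\<exists>A'. A ** A' = mat 1 \<and> A' ** A = mat 1" using assms by blast
  then have "matrix_inv A ** A = mat 1"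
    unfolding matrix_inv_def by (rule someI2_ex) simp
  then show ?thesis
    by (metis assms(1) matrix_mul_assoc matrix_mul_lid matrix_mul_rid)
qed

lemma matrix_inv_two_step:
  assumes "norm u1 < c" "norm u2 < c"
  shows "matrix_inv (two_step c u1 u2) = step_inv c u1 ** step_inv c u2"
proof -
  let ?V = "step_inv c u1 ** step_inv c u2"
  have "?V ** two_step c u1 u2 = mat 1"
    unfolding two_step_def
    by (metis assms matrix_mul_assoc matrix_mul_rid step_inv_mult_step)
  then have "two_step c u1 u2 ** ?V = mat 1" "?V ** two_step c u1 u2 = mat 1"
    by (simp_all add: matrix_left_right_inverse)
  then show ?thesis
    by (rule matrix_inv_eqI)
qed

section \<open>Spatial block and inverse time row of a two-step product\<close>

lemma sum_option_UNIV: "(\<Sum>k\<in>UNIV. f k) = f None + (\<Sum>i\<in>UNIV. f (Some i))"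
  for f :: "'n::finite option \<Rightarrow> real"
  by (simp add: UNIV_option_conv sum.reindex)

lemma spatial_block_vector_mult: "spatial_block M *v x = space_part (M *v event 0 x)"
  by (simp add: vec_eq_iff spatial_block_def space_part_def matrix_vector_mult_def event_def
      sum_option_UNIV)

text \<open>The spatial output of a step does not depend on its time input, so spatial blocks
  multiply.\<close>

lemma spatial_block_two_step:
  assumes "norm u1 < c" "norm u2 < c"
  shows "spatial_block (two_step c u1 u2) = stretch (gam c u2) u2 ** stretch (gam c u1) u1"
  using assms
  by (simp add: spatial_block_vector_mult matrix_eq two_step_def
      matrix_vector_mul_assoc[symmetric] step_vector_mult)

text \<open>The right side is the covector in the time row of the inverse two-step product, which
  identifies the composed velocity there. The coefficients along \<open>sgn u2\<close> combine
  through |u2|^2/c^2 = 1 - 1/gamma^2.\<close>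

lemma composed_velocity_eq_stretch:
  assumes "norm u2 < c"
  shows "gam c u2 *\<^sub>R composed_velocity c u1 u2 = gam c u2 *\<^sub>R u2 + stretch (1 / gam c u2) u2 *v u1"
proof -
  define g s where "g = gam c u2" and "s = sgn u2"
  have g: "g > 0" using gam_pos[OF assms] by (simp add: g_def)
  have u2: "u2 = norm u2 *\<^sub>R s" by (cases "u2 = 0") (simp_all add: s_def sgn_div_norm)
  have "((u1 \<bullet> u2) / c\<^sup>2) *\<^sub>R u2 = ((norm u2)\<^sup>2 / c\<^sup>2 * (s \<bullet> u1)) *\<^sub>R s"
    by (subst (1 2) u2) (simp add: power2_eq_square mult_ac inner_commute)
  also have "(norm u2)\<^sup>2 / c\<^sup>2 = 1 - 1 / g\<^sup>2"
    unfolding g_def by (rule norm_square_eq_gam[OF assms])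
  finally have "g *\<^sub>R composed_velocity c u1 u2
      = g *\<^sub>R u2 - (g * ((1 - 1 / g\<^sup>2) * (s \<bullet> u1))) *\<^sub>R s + u1 + (g * ((1 - 1 / g) * (s \<bullet> u1))) *\<^sub>R s"
    using g by (simp add: composed_velocity_def g_def[symmetric] s_def[symmetric]
        scaleR_diff_left scaleR_add_right scaleR_diff_right)
  also have "\<dots> = g *\<^sub>R u2 + u1 + (g * ((1 - 1 / g) * (s \<bullet> u1)) - g * ((1 - 1 / g\<^sup>2) * (s \<bullet> u1))) *\<^sub>R s"
    by (simp add: scaleR_diff_left)
  also have "g * ((1 - 1 / g) * (s \<bullet> u1)) - g * ((1 - 1 / g\<^sup>2) * (s \<bullet> u1)) = (1 / g - 1) * (s \<bullet> u1)"
    using g by (simp add: field_simps power2_eq_square)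
  finally show ?thesis
    by (simp add: g_def s_def stretch_vector_mult)
qed

text \<open>Only the time row of the inverse enters \<open>q00\<close>. It is k (1, -w^T/c^2) with k
  the product of both Lorentz factors, and its square under \<open>Qstar\<close> is k^2 (1 -
  |w|^2/c^2).\<close>

lemma q00_eq_composed:
  assumes "norm u1 < c" "norm u2 < c"
  shows "q00 c u1 u2 =
    (gam c u1)\<^sup>2 * (gam c u2)\<^sup>2 * (1 - (norm (composed_velocity c u1 u2))\<^sup>2 / c\<^sup>2)"
proof -
  have c: "c \<noteq> 0" using assms norm_ge_zero[of u1] by linarith
  define V where "V = step_inv c u1 ** step_inv c u2"
  define w where "w = composed_velocity c u1 u2"
  define k where "k = gam c u1 * gam c u2"
  have row: "time_part (V *v X) = k * (time_part X - (w \<bullet> space_part X) / c\<^sup>2)" for X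
  proof -
    have "gam c u1 * (gam c u2 * (w \<bullet> space_part X)) =
        gam c u1 * (gam c u2 * (u2 \<bullet> space_part X) + u1 \<bullet> (stretch (1 / gam c u2) u2 *v space_part X))"
      using arg_cong[OF composed_velocity_eq_stretch[OF assms(2), of u1], of "\<lambda>y. y \<bullet> space_part X"]
      by (simp add: w_def inner_add_left inner_symmetric_matrix[OF transpose_stretch])
    then show ?thesis
      by (simp add: V_def k_def matrix_vector_mul_assoc[symmetric] step_inv_vector_mult algebra_simps
          add_divide_distrib[symmetric] diff_divide_distrib[symmetric])
  qed
  have entry: "V $ None $ j = time_part (V *v axis j 1)" for j
    by (simp add: time_part_def matrix_vector_mult_basis column_def)
  have V0: "V $ None $ None = k"
    unfolding entry row by (simp add: time_part_def space_part_def axis_def inner_vec_def)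
  have Vi: "V $ None $ Some i = - k * w $ i / c\<^sup>2" for i
  proof -
    have "space_part (axis (Some i) 1 :: real ^ 'a option) = axis i 1"
      by (simp add: space_part_def axis_def vec_eq_iff)
    then show ?thesis
      unfolding entry row by (simp add: time_part_def axis_def[of "Some i"] inner_axis)
  qed
  have "q00 c u1 u2 = (V ** Qstar c ** transpose V) $ None $ None"
    by (simp add: q00_def matrix_inv_two_step[OF assms] V_def Let_def)
  also have "\<dots> = (\<Sum>j\<in>UNIV. V $ None $ j * (if j = None then 1 else - c\<^sup>2) * V $ None $ j)"
    by (simp add: matrix_matrix_mult_def transpose_def Qstar_def if_distrib[of "\<lambda>x. _ * x"]
        cong: if_cong)
  also have "\<dots> = k * k + (\<Sum>i\<in>UNIV. - (c\<^sup>2 * (k * w $ i / c\<^sup>2)\<^sup>2))"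
    using c by (simp add: sum_option_UNIV V0 Vi power2_eq_square)
  also have "\<dots> = k * k - c\<^sup>2 * (\<Sum>i\<in>UNIV. (k * w $ i / c\<^sup>2)\<^sup>2)"
    by (simp add: sum_negf sum_distrib_left)
  also have "(\<Sum>i\<in>UNIV. (k * w $ i / c\<^sup>2)\<^sup>2) = k\<^sup>2 / (c\<^sup>2)\<^sup>2 * (norm w)\<^sup>2"
    by (simp add: power2_norm_eq_inner inner_vec_def sum_distrib_left power_divide
        power_mult_distrib power2_eq_square[of "w $ _"])
  also have "k * k - c\<^sup>2 * (k\<^sup>2 / (c\<^sup>2)\<^sup>2 * (norm w)\<^sup>2) = k\<^sup>2 * (1 - (norm w)\<^sup>2 / c\<^sup>2)"
    using c by (simp add: field_simps power2_eq_square)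
  finally show ?thesis by (simp add: k_def w_def power_mult_distrib)
qed

text \<open>Expanding |gamma_2 w|^2, the Lorentz factor of the second step cancels through gamma_2^2
  (1 - |u2|^2/c^2) = 1. The result is polynomial in \<open>u2\<close>, which suits an infinitesimal
  second step.\<close>

lemma q00_eq:
  assumes "norm u1 < c" "norm u2 < c"
  shows "q00 c u1 u2 = (gam c u1)\<^sup>2 * ((1 - (u1 \<bullet> u2) / c\<^sup>2)\<^sup>2 - (norm u1)\<^sup>2 / c\<^sup>2)"
proof -
  have c: "c \<noteq> 0" using assms norm_ge_zero[of u1] by linarith
  define g where "g = gam c u2"
  define T where "T = stretch (1 / g) u2"
  have g: "g > 0" using gam_pos[OF assms(2)] by (simp add: g_def)
  have gg: "g\<^sup>2 - g\<^sup>2 * (norm u2)\<^sup>2 / c\<^sup>2 = 1"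
    using gam_square_identity[OF assms(2)] by (simp add: g_def)
  have "1 / (g * g) - 1 = - ((norm u2)\<^sup>2 / c\<^sup>2)"
    using norm_square_eq_gam[OF assms(2)] by (simp add: g_def power2_eq_square)
  then have TT: "(T *v u1) \<bullet> (T *v u1) = (norm u1)\<^sup>2 - (u1 \<bullet> u2)\<^sup>2 / c\<^sup>2"
    using inner_sgn_square[of u2 u1]
    by (simp add: T_def inner_symmetric_matrix[OF transpose_stretch, symmetric]
        matrix_vector_mul_assoc stretch_mult inner_stretch power2_norm_eq_inner inner_commute mult_ac)
  have "(norm (g *\<^sub>R composed_velocity c u1 u2))\<^sup>2
      = g\<^sup>2 * (norm u2)\<^sup>2 + 2 * g * (u2 \<bullet> (T *v u1)) + (T *v u1) \<bullet> (T *v u1)"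
    unfolding g_def T_def composed_velocity_eq_stretch[OF assms(2)] power2_norm_eq_inner
    by (simp add: inner_add_left inner_add_right inner_commute power2_eq_square)
  also have "2 * g * (u2 \<bullet> (T *v u1)) = 2 * (u1 \<bullet> u2)"
    using g by (simp add: T_def inner_stretch_self inner_commute)
  finally have "g\<^sup>2 * (norm (composed_velocity c u1 u2))\<^sup>2
      = g\<^sup>2 * (norm u2)\<^sup>2 + 2 * (u1 \<bullet> u2) + ((norm u1)\<^sup>2 - (u1 \<bullet> u2)\<^sup>2 / c\<^sup>2)"
    by (simp add: TT power_mult_distrib)
  then have "g\<^sup>2 * (1 - (norm (composed_velocity c u1 u2))\<^sup>2 / c\<^sup>2)
      = (g\<^sup>2 - g\<^sup>2 * (norm u2)\<^sup>2 / c\<^sup>2) - 2 * (u1 \<bullet> u2) / c\<^sup>2 - (norm u1)\<^sup>2 / c\<^sup>2 + (u1 \<bullet> u2)\<^sup>2 / c\<^sup>2 / c\<^sup>2"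
    by (simp add: right_diff_distrib add_divide_distrib diff_divide_distrib)
  also have "\<dots> = (1 - (u1 \<bullet> u2) / c\<^sup>2)\<^sup>2 - (norm u1)\<^sup>2 / c\<^sup>2"
    unfolding gg by (simp add: power2_diff power_divide power2_eq_square[of "c\<^sup>2"])
  finally show ?thesis
    by (simp add: q00_eq_composed[OF assms] g_def[symmetric])
qed

lemma q00_expansion:
  assumes "norm u < c" "norm h < c"
  shows "q00 c u h = 1 - 2 * (u \<bullet> h) / (c\<^sup>2 - (norm u)\<^sup>2) + (u \<bullet> h)\<^sup>2 / (c\<^sup>2 * (c\<^sup>2 - (norm u)\<^sup>2))"
proof -
  have c: "c > 0" using assms norm_ge_zero[of u] by linarith
  have pos: "c\<^sup>2 - (norm u)\<^sup>2 > 0" using assms by (simp add: power_strict_mono)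
  have "(gam c u)\<^sup>2 = c\<^sup>2 / (c\<^sup>2 - (norm u)\<^sup>2)"
    unfolding gam_square[OF assms(1)] using c pos by (simp add: field_simps)
  moreover have "(1 - (u \<bullet> h) / c\<^sup>2)\<^sup>2 - (norm u)\<^sup>2 / c\<^sup>2
      = (c\<^sup>2 - (norm u)\<^sup>2 - 2 * (u \<bullet> h) + (u \<bullet> h)\<^sup>2 / c\<^sup>2) / c\<^sup>2"
    using c by (simp add: power2_diff field_simps power2_eq_square)
  ultimately have "q00 c u h
      = (c\<^sup>2 - (norm u)\<^sup>2 - 2 * (u \<bullet> h) + (u \<bullet> h)\<^sup>2 / c\<^sup>2) / (c\<^sup>2 - (norm u)\<^sup>2)"
    using c by (simp add: q00_eq[OF assms])
  also have "\<dots> = 1 - 2 * (u \<bullet> h) / (c\<^sup>2 - (norm u)\<^sup>2) + (u \<bullet> h)\<^sup>2 / (c\<^sup>2 * (c\<^sup>2 - (norm u)\<^sup>2))"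
    using pos by (simp add: add_divide_distrib diff_divide_distrib)
  finally show ?thesis .
qed

lemma q00_remainder_bigo:
  fixes u :: "real ^ 'n"
  assumes "norm u < c"
  shows "(\<lambda>h. q00 c u h - (1 - 2 * (u \<bullet> h) / (c\<^sup>2 - (norm u)\<^sup>2))) \<in> O[at 0](\<lambda>h. (norm h)\<^sup>2)"
proof (rule bigoI)
  have c: "c > 0" using assms norm_ge_zero[of u] by linarith
  have pos: "c\<^sup>2 - (norm u)\<^sup>2 > 0" using assms by (simp add: power_strict_mono)
  \<comment> \<open>The exact remainder is (u . h)^2 / A, so Cauchy-Schwarz gives the constant |u|^2
    / A.\<close>
  define A where "A = c\<^sup>2 * (c\<^sup>2 - (norm u)\<^sup>2)"
  have A: "A > 0" using c pos by (simp add: A_def)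
  have "\<forall>\<^sub>F h in at 0. norm (h :: real ^ 'n) < c"
    using c by (auto simp: eventually_at dist_norm)
  then show "\<forall>\<^sub>F h in at 0. norm (q00 c u h - (1 - 2 * (u \<bullet> h) / (c\<^sup>2 - (norm u)\<^sup>2)))
      \<le> (norm u)\<^sup>2 / A * norm ((norm h)\<^sup>2)"
  proof eventually_elim
    case (elim h)
    have "(u \<bullet> h)\<^sup>2 \<le> (norm u)\<^sup>2 * (norm h)\<^sup>2"
      using Cauchy_Schwarz_ineq[of u h] by (simp add: power2_norm_eq_inner)
    then show ?case
      using A q00_expansion[OF assms elim] by (simp add: A_def[symmetric] divide_right_mono)
  qed
qed

section \<open>The frequency form\<close>

text \<open>On |h| < c the polynomial of \<open>q00_expansion\<close> may be differentiated in place
  of \<open>q00\<close>. It equals 1 at 0, so the derivative is -1/2 times its linear term.\<close>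

lemma ln_dilation_has_derivative:
  fixes u :: "real ^ 'n"
  assumes "norm u < c"
  shows "((\<lambda>h. ln (dilation c u h)) has_derivative (\<lambda>h. (u \<bullet> h) / (c\<^sup>2 - (norm u)\<^sup>2))) (at 0)"
proof -
  have c: "c > 0" using assms norm_ge_zero[of u] by linarith
  have pos: "c\<^sup>2 - (norm u)\<^sup>2 > 0" using assms by (simp add: power_strict_mono)
  define B where "B = c\<^sup>2 - (norm u)\<^sup>2"
  have B: "B > 0" using pos by (simp add: B_def)
  define q where "q h = 1 - 2 * (u \<bullet> h) / B + (u \<bullet> h)\<^sup>2 / (c\<^sup>2 * B)" for h
  have "((\<lambda>h. ln (1 / sqrt (q h))) has_derivative (\<lambda>h. (u \<bullet> h) / B)) (at 0)"
    unfolding q_def using B c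
    by (auto intro!: derivative_eq_intros)
  then show ?thesis
    unfolding B_def[symmetric]
  proof (rule has_derivative_transform_within_open[where s = "ball 0 c"])
    show "ln (1 / sqrt (q h)) = ln (dilation c u h)" if "h \<in> ball 0 c" for h
      using that q00_expansion[OF assms, of h] by (simp add: dilation_def q_def B_def)
  qed (use c in auto)
qed

lemma freq_form_eq:
  assumes "norm u < c"
  shows "freq_form c u = (\<lambda>h. (u \<bullet> h) / (c\<^sup>2 - (norm u)\<^sup>2))"
  unfolding freq_form_def
  using frechet_derivative_at[OF ln_dilation_has_derivative[OF assms]] by simp

text \<open>Here the base point varies, whereas \<open>freq_form\<close> differentiates in the
  second step at 0. The agreement of both makes ln gamma a potential, hence exactness and path
  independence.\<close>

lemma ln_gam_has_derivative:
  fixes u :: "real ^ 'n"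
  assumes "norm u < c"
  shows "((\<lambda>v. ln (gam c v)) has_derivative freq_form c u) (at u)"
proof -
  have c: "c > 0" using assms norm_ge_zero[of u] by linarith
  define C A where "C = c\<^sup>2" and "A = 1 - (u \<bullet> u) / C"
  have A: "A > 0" "C > 0"
    using gam_args(1)[OF assms] c by (simp_all add: A_def C_def power2_norm_eq_inner)
  have "((\<lambda>v. 1 - (v \<bullet> v) / C) has_derivative (\<lambda>h. - 2 * ((u \<bullet> h) / C))) (at u)"
    using A by (auto intro!: derivative_eq_intros simp: inner_commute)
  from has_derivative_mult_right[OF has_derivative_ln[OF _ this], of "- 1 / 2"]
  have "((\<lambda>v. - ln (1 - (v \<bullet> v) / C) / 2) has_derivative (\<lambda>h. ((u \<bullet> h) / C) / A)) (at u)"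
    using A by (simp add: A_def[symmetric] inverse_eq_divide)
  moreover have "c\<^sup>2 * A = c\<^sup>2 - (norm u)\<^sup>2"
    using c by (simp add: A_def C_def power2_norm_eq_inner field_simps)
  ultimately have "((\<lambda>v. - ln (1 - (v \<bullet> v) / c\<^sup>2) / 2) has_derivative freq_form c u) (at u)"
    by (simp add: freq_form_eq[OF assms] C_def)
  then show ?thesis
  proof (rule has_derivative_transform_within_open[where s = "ball 0 c"])
    show "- ln (1 - (v \<bullet> v) / c\<^sup>2) / 2 = ln (gam c v)" if "v \<in> ball 0 c" for v
      using gam_args(1)[of v c] that
      by (simp add: gam_def ln_div ln_sqrt power2_norm_eq_inner)
  qed (use assms in auto)
qed

text \<open>The fundamental theorem of calculus for ln gamma along \<open>p\<close>. The composition
  is continuous on the whole interval, so the finitely many corners in \<open>S\<close> do no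
  harm.\<close>

lemma freq_form_has_line_integral:
  fixes p :: "real \<Rightarrow> real ^ 'n"
  assumes "valid_path p" "path_image p \<subseteq> ball 0 c"
  shows "has_line_integral (freq_form c) (ln (gam c (pathfinish p)) - ln (gam c (pathstart p))) p"
proof -
  obtain S where S: "finite S" "p C1_differentiable_on ({0..1} - S)" and cont: "continuous_on {0..1} p"
    using assms(1) by (auto simp: valid_path_def piecewise_C1_differentiable_on_def)
  have p: "norm (p t) < c" if "t \<in> {0..1}" for t
    using assms(2) that by (auto simp: path_image_def image_subset_iff)
  have "continuous_on (ball 0 c) (\<lambda>v :: real ^ 'n. ln (gam c v))"
    by (intro continuous_at_imp_continuous_on ballI)
      (rule has_derivative_continuous[OF ln_gam_has_derivative], simp)
  then have "continuous_on {0..1} (\<lambda>t. ln (gam c (p t)))"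
    by (rule continuous_on_compose2[OF _ cont]) (use p in auto)
  moreover have "((\<lambda>t. ln (gam c (p t))) has_vector_derivative
      freq_form c (p t) (vector_derivative p (at t within {0..1}))) (at t)"
    if t: "t \<in> {0<..<1} - S" for t
  proof -
    have "(p has_vector_derivative vector_derivative p (at t)) (at t)"
      using S(2) t by (auto simp: C1_differentiable_on_eq vector_derivative_works)
    \<comment> \<open>Line integrals use the derivative within the closed interval, which at
      interior points is the two-sided one.\<close>
    moreover have "at t within {0..1} = at t"
      using t by (auto intro: at_within_Icc_at)
    ultimately have pd: "(p has_derivative (\<lambda>x. x *\<^sub>R vector_derivative p (at t within {0..1}))) (at t)"
      by (simp add: has_vector_derivative_def)
    have ln: "((\<lambda>v. ln (gam c v)) has_derivative freq_form c (p t)) (at (p t))"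
      using t by (intro ln_gam_has_derivative p) auto
    have "linear (freq_form c (p t))"
      using ln by (rule has_derivative_linear)
    then show ?thesis
      using has_derivative_compose[OF pd ln]
      by (simp add: has_vector_derivative_def linear_scale)
  qed
  ultimately show ?thesis
    unfolding has_line_integral_def pathfinish_def pathstart_def
    by (intro fundamental_theorem_of_calculus_interior_strong[OF S(1)]) auto
qed

lemma transport_factor_eq:
  fixes p :: "real \<Rightarrow> real ^ 'n"
  assumes "valid_path p" "path_image p \<subseteq> ball 0 c"
  shows "transport_factor c p = gam c (pathfinish p) / gam c (pathstart p)"
proof -
  have "norm (pathfinish p) < c" "norm (pathstart p) < c"
    using assms(2) pathfinish_in_path_image[of p] pathstart_in_path_image[of p] by auto
  then have "gam c (pathfinish p) > 0" "gam c (pathstart p) > 0"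
    by (auto intro: gam_pos)
  then show ?thesis
    using integral_unique[OF freq_form_has_line_integral[OF assms, unfolded has_line_integral_def]]
    by (simp add: transport_factor_def line_integral_def exp_diff)
qed

text \<open>By \<open>q00_eq_composed\<close>, positivity of \<open>q00\<close> amounts to |w| < c,
  and the reciprocal square root of the product splits into Lorentz factors.\<close>

lemma dilation_eq_gam_defect:
  assumes "norm u1 < c" "norm u2 < c" "q00 c u1 u2 > 0"
  shows "norm (composed_velocity c u1 u2) < c"
    and "dilation c u1 u2 = gam c (composed_velocity c u1 u2) / (gam c u1 * gam c u2)"
proof -
  have c: "c > 0" using assms norm_ge_zero[of u1] by linarith
  have g: "gam c u1 > 0" "gam c u2 > 0" using assms by (auto intro: gam_pos)
  then have k: "(gam c u1)\<^sup>2 * (gam c u2)\<^sup>2 > 0" by simp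
  have "1 - (norm (composed_velocity c u1 u2))\<^sup>2 / c\<^sup>2 > 0"
    using assms(3) k unfolding q00_eq_composed[OF assms(1,2)] by (simp add: zero_less_mult_iff)
  then have "(norm (composed_velocity c u1 u2))\<^sup>2 < c\<^sup>2" using c by simp
  then show "norm (composed_velocity c u1 u2) < c"
    using c power_less_imp_less_base[of _ 2 c] by simp
  show "dilation c u1 u2 = gam c (composed_velocity c u1 u2) / (gam c u1 * gam c u2)"
    using g by (simp add: dilation_def q00_eq_composed[OF assms(1,2)] real_sqrt_mult
        gam_def[of _ "composed_velocity c u1 u2"])
qed

section \<open>The rotation channel\<close>

text \<open>Both stretches and the factor \<open>P\<close> have positive determinant, which leaves
  determinant 1 rather than -1 for the orthogonal factor.\<close>

lemma two_step_polar:
  fixes u1 u2 :: "real ^ 'n"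
  assumes "norm u1 < c" "norm u2 < c"
  shows "rotation_matrix (two_step_rotation c u1 u2)"
    and "\<exists>P. pos_def_matrix P \<and> spatial_block (two_step c u1 u2) = two_step_rotation c u1 u2 ** P"
proof -
  let ?S = "spatial_block (two_step c u1 u2)" and ?R = "two_step_rotation c u1 u2"
  have det: "det ?S > 0"
    unfolding spatial_block_two_step[OF assms] det_mul
    by (intro mult_pos_pos pos_def_det_pos pos_def_stretch gam_pos assms)
  then have "invertible ?S" by (simp add: invertible_det_nz)
  note props = orthogonal_polar_factor_props[OF this, folded two_step_rotation_def]
  from props(2) show ex: "\<exists>P. pos_def_matrix P \<and> ?S = ?R ** P" .
  then obtain P where P: "pos_def_matrix P" "?S = ?R ** P" by blast
  then have "det ?R > 0"
    using det pos_def_det_pos[OF P(1)] by (simp add: det_mul zero_less_mult_iff)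
  then have "det ?R = 1"
    using det_orthogonal_matrix[OF props(1)] by auto
  then show "rotation_matrix ?R"
    using props(1) by (simp add: rotation_matrix_def)
qed

text \<open>Instance of \<open>polar_factor_near_id\<close>: \<open>B\<close> is the stretch of the
  base step and the perturbation is gamma(h) - 1 along \<open>sgn h\<close>, the source of the
  quadratic smallness.\<close>

lemma norm_two_step_rotation_minus_id_le:
  fixes u h :: "real ^ 'n"
  assumes "norm u < c" "norm h < c"
  shows "norm (two_step_rotation c u h - mat 1) \<le> 2 * (gam c h - 1) * gam c u"
proof -
  obtain P where P: "pos_def_matrix P"
    and eq: "spatial_block (two_step c u h) = two_step_rotation c u h ** P"
    using two_step_polar(2)[OF assms] by blast
  let ?B = "stretch (gam c u) u"
  have g: "1 \<le> gam c u" "1 \<le> gam c h" using assms by (auto intro: gam_ge_1)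
  have "norm (two_step_rotation c u h - mat 1)
      \<le> 2 * (gam c h - 1) * norm (sgn h) * norm (?B *v sgn h)"
  proof (rule polar_factor_near_id[OF _ P])
    show "orthogonal_matrix (two_step_rotation c u h)"
      using two_step_polar(1)[OF assms] by (simp add: rotation_matrix_def)
    show "(mat 1 + (gam c h - 1) *\<^sub>R outer (sgn h) (sgn h)) ** ?B = two_step_rotation c u h ** P"
      by (simp add: eq[symmetric] spatial_block_two_step[OF assms] stretch_def[of "gam c h"])
  qed (use g in \<open>auto simp: transpose_stretch inner_le_inner_stretch\<close>)
  also have "\<dots> \<le> 2 * (gam c h - 1) * 1 * (gam c u * 1)"
    using g by (intro mult_mono order_trans[OF norm_stretch_vector_le] mult_left_mono)
      (auto simp: norm_sgn)
  finally show ?thesis by simp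
qed

text \<open>Chains 1/sqrt(1-s) <= 1/(1-s) <= 1 + 2s for s = |h|^2/c^2. The last inequality holds for
  0 <= s <= 1/2, and |h| <= c/2 gives s <= 1/4.\<close>

lemma gam_minus_1_le:
  assumes "norm h \<le> c / 2" "c > 0"
  shows "gam c h - 1 \<le> 2 * (norm h)\<^sup>2 / c\<^sup>2"
proof -
  define s where "s = (norm h)\<^sup>2 / c\<^sup>2"
  have "(norm h)\<^sup>2 \<le> (c / 2)\<^sup>2" using assms by (intro power_mono) auto
  then have s: "0 \<le> s" "s \<le> 1 / 4" using assms by (auto simp: s_def field_simps)
  then have "(1 - s)\<^sup>2 \<le> 1 - s" by (simp add: power2_eq_square mult_left_le)
  then have "1 - s \<le> sqrt (1 - s)" by (rule real_le_rsqrt)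
  then have "1 / sqrt (1 - s) \<le> 1 / (1 - s)"
    using s by (intro divide_left_mono) auto
  also have "\<dots> \<le> 1 + 2 * s"
  proof -
    have "0 \<le> s * (1 - 2 * s)" using s by simp
    then show ?thesis using s by (simp add: field_simps)
  qed
  finally show ?thesis by (simp add: gam_def s_def)
qed

text \<open>The constant depends on the speed bound \<open>r\<close> only, as the accumulation over many steps needs.\<close>
lemma two_step_rotation_quadratic:
  assumes "c > 0" "r < c"
  obtains C where "C \<ge> 0"
    "\<And>u h :: real ^ 'n. norm u \<le> r \<Longrightarrow> norm h \<le> c / 2 \<Longrightarrow>
       norm (two_step_rotation c u h - mat 1) \<le> C * (norm h)\<^sup>2"
proof (cases "r < 0")
  case True
  show ?thesis
  proof (rule that[of 0])
    show "norm (two_step_rotation c u h - mat 1) \<le> 0 * (norm h)\<^sup>2" if "norm u \<le> r" for u h :: "real ^ 'n"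
      using that True norm_ge_zero[of u] by linarith
  qed simp
next
  case False
  \<comment> \<open>The Lorentz factor at speed \<open>r\<close>, bounding \<open>gam c u\<close>
    uniformly.\<close>
  define G where "G = 1 / sqrt (1 - r\<^sup>2 / c\<^sup>2)"
  have "r\<^sup>2 < c\<^sup>2" using assms False by (intro power_strict_mono) auto
  then have r: "0 < 1 - r\<^sup>2 / c\<^sup>2" using assms by simp
  then have G: "G > 0" by (simp add: G_def)
  show ?thesis
  proof (rule that[of "4 * G / c\<^sup>2"])
    fix u h :: "real ^ 'n" assume u: "norm u \<le> r" and h: "norm h \<le> c / 2"
    have lt: "norm u < c" "norm h < c" using u h assms by auto
    have "1 - r\<^sup>2 / c\<^sup>2 \<le> 1 - (norm u)\<^sup>2 / c\<^sup>2"
      using u by (simp add: divide_right_mono power_mono)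
    then have "gam c u \<le> G"
      unfolding gam_def G_def using r by (intro divide_left_mono) auto
    have "norm (two_step_rotation c u h - mat 1) \<le> 2 * (gam c h - 1) * gam c u"
      by (rule norm_two_step_rotation_minus_id_le[OF lt])
    also have "\<dots> \<le> 2 * (2 * (norm h)\<^sup>2 / c\<^sup>2) * G"
      using gam_minus_1_le[OF h assms(1)] \<open>gam c u \<le> G\<close> gam_pos[OF lt(1)] gam_ge_1[OF lt(2)]
      by (intro mult_mono) auto
    finally show "norm (two_step_rotation c u h - mat 1) \<le> 4 * G / c\<^sup>2 * (norm h)\<^sup>2"
      by (simp add: mult_ac)
  qed (use G in simp)
qed

lemma rotation_angle_bigo:
  fixes u :: "real ^ 'n"
  assumes "norm u < c"
  shows "(\<lambda>h. rotation_angle (two_step_rotation c u h)) \<in> O[at 0](\<lambda>h. (norm h)\<^sup>2)"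
proof -
  have c: "c > 0" using assms norm_ge_zero[of u] by linarith
  obtain C where C: "C \<ge> 0"
    and bound: "\<And>u' h :: real ^ 'n. norm u' \<le> norm u \<Longrightarrow> norm h \<le> c / 2 \<Longrightarrow>
       norm (two_step_rotation c u' h - mat 1) \<le> C * (norm h)\<^sup>2"
    using two_step_rotation_quadratic[OF c assms] by blast
  \<comment> \<open>Near 0 the bound drops below 1, the distance from the identity that
    \<open>rotation_angle_bounds\<close> admits.\<close>
  have "((\<lambda>h :: real ^ 'n. C * (norm h)\<^sup>2) \<longlongrightarrow> C * (norm (0 :: real ^ 'n))\<^sup>2) (at 0)"
    by (intro tendsto_intros)
  then have ev1: "\<forall>\<^sub>F h :: real ^ 'n in at 0. C * (norm h)\<^sup>2 < 1"
    by (rule order_tendstoD) simp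
  have ev2: "\<forall>\<^sub>F h in at 0. norm (h :: real ^ 'n) < c / 2"
    unfolding eventually_at using c by (intro exI[of _ "c / 2"]) (auto simp: dist_norm)
  show ?thesis
  proof (rule bigoI)
    show "\<forall>\<^sub>F h in at 0. norm (rotation_angle (two_step_rotation c u h)) \<le> C * norm ((norm h)\<^sup>2)"
      using ev1 ev2
    proof eventually_elim
      case (elim h)
      have "orthogonal_matrix (two_step_rotation c u h)"
        using two_step_polar(1)[OF assms, of h] elim c by (simp add: rotation_matrix_def)
      from rotation_angle_bounds[OF this] bound[of u h] elim show ?case by simp
    qed
  qed
qed

text \<open>Each of the N steps deviates from the identity by O(1/N^2), in total by O(1/N). The
  smallness conditions on the increments hold from some N on.\<close>

lemma accumulated_rotation_tendsto:
  fixes U D :: "nat \<Rightarrow> nat \<Rightarrow> real ^ 'n"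
  assumes c: "c > 0" and r: "r < c"
    and bnd: "\<And>N k. k < N \<Longrightarrow> norm (U N k) \<le> r \<and> norm (D N k) \<le> K / real N"
  shows "(\<lambda>N. \<Sum>k<N. rotation_angle (two_step_rotation c (U N k) (D N k))) \<longlonglongrightarrow> 0"
    and "(\<lambda>N. accumulated (\<lambda>k. two_step_rotation c (U N k) (D N k)) N) \<longlonglongrightarrow> mat 1"
proof -
  obtain C where C: "C \<ge> 0"
    and quad: "\<And>u h :: real ^ 'n. norm u \<le> r \<Longrightarrow> norm h \<le> c / 2 \<Longrightarrow>
       norm (two_step_rotation c u h - mat 1) \<le> C * (norm h)\<^sup>2"
    using two_step_rotation_quadratic[OF c r] by blast
  define R where "R N k = two_step_rotation c (U N k) (D N k)" for N k
  have KN: "(\<lambda>N. K / real N) \<longlonglongrightarrow> 0"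
    by (rule lim_const_over_n)
  have ev1: "\<forall>\<^sub>F N in sequentially. K / real N < c / 2"
    using c by (intro order_tendstoD(2)[OF KN]) simp
  have "(\<lambda>N. C * (K / real N)\<^sup>2) \<longlonglongrightarrow> C * 0\<^sup>2"
    by (intro tendsto_intros KN)
  then have ev2: "\<forall>\<^sub>F N in sequentially. C * (K / real N)\<^sup>2 < 1"
    by (rule order_tendstoD) simp
  have lim: "(\<lambda>N. C * K\<^sup>2 / real N) \<longlonglongrightarrow> 0"
    by (rule lim_const_over_n)
  have each: "orthogonal_matrix (R N k)" "norm (R N k - mat 1) \<le> C * (K / real N)\<^sup>2"
    if "K / real N < c / 2" "k < N" for N k
  proof -
    have U: "norm (U N k) \<le> r" and D: "norm (D N k) \<le> K / real N"
      using bnd[OF that(2)] by auto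
    have "norm (U N k) < c" "norm (D N k) < c" using U D r c that(1) by linarith+
    then show "orthogonal_matrix (R N k)"
      using two_step_polar(1) by (auto simp: R_def rotation_matrix_def)
    have "norm (R N k - mat 1) \<le> C * (norm (D N k))\<^sup>2"
      unfolding R_def by (intro quad U) (use D that(1) in linarith)
    also have "\<dots> \<le> C * (K / real N)\<^sup>2"
      using C D by (intro mult_left_mono power_mono) auto
    finally show "norm (R N k - mat 1) \<le> C * (K / real N)\<^sup>2" .
  qed
  have sum: "(\<Sum>k<N. norm (R N k - mat 1)) \<le> C * K\<^sup>2 / real N" if "K / real N < c / 2" for N
  proof -
    have "(\<Sum>k<N. norm (R N k - mat 1)) \<le> (\<Sum>k<N. C * (K / real N)\<^sup>2)"
      using each(2)[OF that] by (intro sum_mono) auto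
    \<comment> \<open>Also for \<open>N = 0\<close>, where both sides are 0 since division by zero
      yields 0.\<close>
    also have "\<dots> = C * K\<^sup>2 / real N" by (simp add: power2_eq_square field_simps)
    finally show ?thesis .
  qed
  have "\<forall>\<^sub>F N in sequentially. norm (\<Sum>k<N. rotation_angle (R N k)) \<le> C * K\<^sup>2 / real N"
    using ev1 ev2
  proof eventually_elim
    case (elim N)
    have b: "0 \<le> rotation_angle (R N k)" "rotation_angle (R N k) \<le> norm (R N k - mat 1)"
      if "k < N" for k
      using rotation_angle_bounds[OF each(1)] each(2)[OF elim(1) that] elim that by force+
    have "norm (\<Sum>k<N. rotation_angle (R N k)) = (\<Sum>k<N. rotation_angle (R N k))"
      unfolding real_norm_def by (intro abs_of_nonneg sum_nonneg b(1)) auto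
    also have "\<dots> \<le> (\<Sum>k<N. norm (R N k - mat 1))"
      using b(2) by (intro sum_mono) auto
    finally show ?case using sum[OF elim(1)] by linarith
  qed
  then show "(\<lambda>N. \<Sum>k<N. rotation_angle (two_step_rotation c (U N k) (D N k))) \<longlonglongrightarrow> 0"
    unfolding R_def by (rule Lim_null_comparison[OF _ lim])
  have "\<forall>\<^sub>F N in sequentially. norm (accumulated (R N) N - mat 1) \<le> C * K\<^sup>2 / real N"
    using ev1
  proof eventually_elim
    case (elim N)
    have "norm (accumulated (R N) N - mat 1) \<le> (\<Sum>k<N. norm (R N k - mat 1))"
      using each(1)[OF elim] by (intro norm_accumulated_minus_id_le) auto
    then show ?case using sum[OF elim] by linarith
  qed
  then have "(\<lambda>N. accumulated (R N) N - mat 1) \<longlonglongrightarrow> 0"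
    by (rule Lim_null_comparison[OF _ lim])
  then show "(\<lambda>N. accumulated (\<lambda>k. two_step_rotation c (U N k) (D N k)) N) \<longlonglongrightarrow> mat 1"
    unfolding R_def by (simp add: LIM_zero_iff)
qed

theorem proposition27:
  fixes c :: real
  assumes c: "c > 0" and d: "CARD('n::finite) = 2 \<or> CARD('n) = 3"
  shows
    "(\<forall>u::real^'n. norm u < c \<longrightarrow>
        (\<lambda>h. q00 c u h - (1 - 2 * (u \<bullet> h) / (c\<^sup>2 - (norm u)\<^sup>2))) \<in> O[at 0](\<lambda>h. (norm h)\<^sup>2)
      \<and> ((\<lambda>h. ln (dilation c u h)) has_derivative freq_form c u) (at 0)
      \<and> freq_form c u = (\<lambda>h. (u \<bullet> h) / (c\<^sup>2 - (norm u)\<^sup>2))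
      \<and> ((\<lambda>v. ln (gam c v)) has_derivative freq_form c u) (at u))
   \<and> exact_form_on (ball (0::real^'n) c) (freq_form c)
   \<and> (\<forall>p::real \<Rightarrow> real^'n. valid_path p \<and> path_image p \<subseteq> ball 0 c \<longrightarrow>
        (\<exists>I. has_line_integral (freq_form c) I p)
      \<and> transport_factor c p = gam c (pathfinish p) / gam c (pathstart p)
      \<and> (pathfinish p = pathstart p \<longrightarrow> transport_factor c p = 1))
   \<and> (\<forall>u1 u2::real^'n. norm u1 < c \<and> norm u2 < c \<and> q00 c u1 u2 > 0 \<longrightarrow>
        norm (composed_velocity c u1 u2) < c
      \<and> dilation c u1 u2 = gam c (composed_velocity c u1 u2) / (gam c u1 * gam c u2))
   \<and> (\<forall>u1 u2::real^'n. norm u1 < c \<and> norm u2 < c \<longrightarrow>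
        rotation_matrix (two_step_rotation c u1 u2)
      \<and> (\<exists>P. pos_def_matrix P \<and>
             spatial_block (two_step c u1 u2) = two_step_rotation c u1 u2 ** P))
   \<and> (\<forall>u::real^'n. norm u < c \<longrightarrow>
        (\<lambda>h. rotation_angle (two_step_rotation c u h)) \<in> O[at 0](\<lambda>h. (norm h)\<^sup>2))
   \<and> (\<forall>r K. \<forall>(U :: nat \<Rightarrow> nat \<Rightarrow> real^'n) D.
        r < c \<and> (\<forall>N. \<forall>k<N. norm (U N k) \<le> r \<and> norm (D N k) \<le> K / real N) \<longrightarrow>
        (\<lambda>N. \<Sum>k<N. rotation_angle (two_step_rotation c (U N k) (D N k))) \<longlonglongrightarrow> 0
      \<and> (\<lambda>N. accumulated (\<lambda>k. two_step_rotation c (U N k) (D N k)) N) \<longlonglongrightarrow> mat 1)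
   \<and> continuum_flat (ball (0::real^'n) c) (freq_form c)
        (\<lambda>u h. rotation_angle (two_step_rotation c u h))"
proof (intro conjI allI impI)
  fix p :: "real \<Rightarrow> real ^ 'n"
  assume p: "valid_path p \<and> path_image p \<subseteq> ball 0 c"
  then show "\<exists>I. has_line_integral (freq_form c) I p"
    using freq_form_has_line_integral by blast
  show tf: "transport_factor c p = gam c (pathfinish p) / gam c (pathstart p)"
    using p transport_factor_eq by blast
  assume "pathfinish p = pathstart p"
  \<comment> \<open>Positivity rules out a quotient 0/0 on a loop.\<close>
  moreover have "gam c (pathstart p) > 0"
    using p pathstart_in_path_image[of p] by (intro gam_pos) auto
  ultimately show "transport_factor c p = 1"
    by (simp add: tf)
next
  show "exact_form_on (ball (0::real^'n) c) (freq_form c)"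
    unfolding exact_form_on_def using ln_gam_has_derivative by (metis mem_ball_0)
next
  show "continuum_flat (ball (0::real^'n) c) (freq_form c)
        (\<lambda>u h. rotation_angle (two_step_rotation c u h))"
    unfolding continuum_flat_def
  proof (intro conjI allI impI ballI)
    fix p :: "real \<Rightarrow> real ^ 'n"
    assume "valid_path p \<and> path_image p \<subseteq> ball 0 c \<and> pathfinish p = pathstart p"
    then show "has_line_integral (freq_form c) 0 p"
      using freq_form_has_line_integral[of p c] by simp
  qed (simp add: rotation_angle_bigo)
next
  fix r K and U D :: "nat \<Rightarrow> nat \<Rightarrow> real ^ 'n"
  assume *: "r < c \<and> (\<forall>N. \<forall>k<N. norm (U N k) \<le> r \<and> norm (D N k) \<le> K / real N)"
  show "(\<lambda>N. \<Sum>k<N. rotation_angle (two_step_rotation c (U N k) (D N k))) \<longlonglongrightarrow> 0"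
    by (rule accumulated_rotation_tendsto(1)[OF c, of r U D K]) (use * in auto)
  show "(\<lambda>N. accumulated (\<lambda>k. two_step_rotation c (U N k) (D N k)) N) \<longlonglongrightarrow> mat 1"
    by (rule accumulated_rotation_tendsto(2)[OF c, of r U D K]) (use * in auto)
next
  fix u :: "real ^ 'n" assume u: "norm u < c"
  show "((\<lambda>h. ln (dilation c u h)) has_derivative freq_form c u) (at 0)"
    unfolding freq_form_eq[OF u] by (rule ln_dilation_has_derivative[OF u])
qed (use q00_remainder_bigo freq_form_eq ln_gam_has_derivative dilation_eq_gam_defect two_step_polar
    rotation_angle_bigo in auto)

end
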